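(* Let $G$ be a free group on $r\geq 1$ generators, and let $S$ be a free set of generators of $G$. Assume $\mu$ is a probability measure on $G$ whose support is contained in $S\cup S^{-1}\cup\{e\}$, and let $(Y_n)_{n\geq 0}$ be a right random walk on $G$ with increments distributed according to $\mu$. Let $\ell$ be the word length on $G$ determined by $S$. Then the sequence of random variables $\bigl(\frac{1}{n}\ell(Y_n)\bigr)_{n\geq 1}$ satisfies the large deviation principle with a proper, convex rate function $I\colon\mathbb{R}_{\geq 0}\to[0,\infty]$, which coincides with the Fenchel-Legendre transform of the limiting logarithmic moment generating function $\Lambda$ of $\bigl(\frac{1}{n}\ell(Y_n)\bigr)_{n\geq 1}$, that is, $I(x)=\sup_{z\in\mathbb{R}}\{zx-\Lambda(z)\}$ for every $x\in\mathbb{R}_{\geq 0}$, where $\Lambda(z)=\limsup_{n\to\infty}\frac{1}{n}\log\mathbb{E}[e^{z\ell(Y_n)}]$ for $z\in\mathbb{R}$.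
   Context: Word length: $\ell(g)$ is the least $n\in\mathbb{N}$ such that $g=s_1\cdots s_n$ with $s_1,\dots,s_n\in S\cup S^{-1}$, and $\ell(e)=0$, where $e$ is the identity of $G$. Random walk: $Y_0=e$ and $Y_n=X_1\cdots X_n$ for $n\geq 1$, where $(X_n)_{n\geq 1}$ are independent $G$-valued random variables with common law $\mu$ on a probability space $(\Omega,\mathcal{F},\mathbb{P})$; $\mathbb{E}$ is expectation with respect to $\mathbb{P}$. The support of $\mu$ is $\{g\in G:\mu(g)>0\}$. Large deviation principle (conventions $\log 0=-\infty$, $\inf\emptyset=\infty$): let $(Z_n)_{n\geq 1}$ be random variables with values in a Hausdorff regular topological space $X$ (here $X=\mathbb{R}_{\geq 0}$), with laws $\mu_n$, and let $I\colon X\to[0,\infty]$ be lower semicontinuous. $(Z_n)$ satisfies the large deviation principle with rate function $I$ if $\liminf_{n}\frac{1}{n}\log\mu_n(V)\geq-\inf_{x\in V}I(x)$ for every open $V\subset X$ and $\limsup_{n}\frac{1}{n}\log\mu_n(F)\leq-\inf_{x\in F}I(x)$ for every closed $F\subset X$. The rate function $I$ is proper if $\{x\in X:I(x)\leq\alpha\}$ is compact for every $\alpha\in[0,\infty)$. *)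

theory Defs
  imports
    "HOL-Probability.Probability"
    "HOL-Algebra.Generated_Groups"
begin

section \<open>Free groups and word length\<close>

definition word_product :: "('a, 'b) monoid_scheme \<Rightarrow> 'a list \<Rightarrow> 'a" where
  "word_product G gs = foldr (\<otimes>\<^bsub>G\<^esub>) gs \<one>\<^bsub>G\<^esub>"

text \<open>
  A formal letter is a generator \<open>s\<close> together with a sign: \<open>(s, True)\<close> stands for \<open>s\<close> and
  \<open>(s, False)\<close> for its formal inverse. Formal signs are needed because the reducedness of a
  word must not depend on relations that happen to hold in \<open>G\<close> (such as \<open>s = inv s\<close>).
\<close>

definition letter_value :: "('a, 'b) monoid_scheme \<Rightarrow> 'a \<times> bool \<Rightarrow> 'a" where
  "letter_value G l = (if snd l then fst l else inv\<^bsub>G\<^esub> (fst l))"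

definition reduced_word :: "('a \<times> bool) list \<Rightarrow> bool" where
  "reduced_word = successively (\<lambda>l m. \<not> (fst l = fst m \<and> snd l \<noteq> snd m))"

definition free_generators :: "('a, 'b) monoid_scheme \<Rightarrow> 'a set \<Rightarrow> bool" where
  "free_generators G S \<longleftrightarrow>
     S \<subseteq> carrier G \<and> generate G S = carrier G \<and>
     (\<forall>w. set w \<subseteq> S \<times> UNIV \<longrightarrow> reduced_word w \<longrightarrow> w \<noteq> [] \<longrightarrow>
        word_product G (map (letter_value G) w) \<noteq> \<one>\<^bsub>G\<^esub>)"

definition word_length :: "('a, 'b) monoid_scheme \<Rightarrow> 'a set \<Rightarrow> 'a \<Rightarrow> nat" where
  "word_length G S g =
     (LEAST n. \<exists>gs. length gs = n \<and> set gs \<subseteq> S \<union> m_inv G ` S \<and> g = word_product G gs)"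

section \<open>Random walks\<close>

text \<open>The increment \<open>X 0\<close> is never used: the walk at time \<open>n\<close> is \<open>X 1 \<otimes> \<dots> \<otimes> X n\<close>.\<close>

primrec right_walk ::
  "('a, 'b) monoid_scheme \<Rightarrow> (nat \<Rightarrow> 'w \<Rightarrow> 'a) \<Rightarrow> nat \<Rightarrow> 'w \<Rightarrow> 'a" where
  "right_walk G X 0 \<omega> = \<one>\<^bsub>G\<^esub>"
| "right_walk G X (Suc n) \<omega> = right_walk G X n \<omega> \<otimes>\<^bsub>G\<^esub> X (Suc n) \<omega>"

section \<open>Large deviations\<close>

definition ext_log :: "ennreal \<Rightarrow> ereal" where
  "ext_log p = (if p = 0 then -\<infinity> else if p = \<infinity> then \<infinity> else ereal (ln (enn2real p)))"

definition borel_of :: "'x topology \<Rightarrow> 'x measure" where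
  "borel_of T = sigma (topspace T) {V. openin T V}"

definition lower_semicontinuous_in :: "'x topology \<Rightarrow> ('x \<Rightarrow> ereal) \<Rightarrow> bool" where
  "lower_semicontinuous_in T I \<longleftrightarrow> (\<forall>\<alpha>. closedin T {x \<in> topspace T. I x \<le> \<alpha>})"

text \<open>
  Only the values of the rate function on \<open>topspace T\<close> are relevant. The infimum over the empty
  set is \<open>\<infinity>\<close> in \<^typ>\<open>ereal\<close>.
\<close>

definition large_deviation_principle ::
  "'w measure \<Rightarrow> 'x topology \<Rightarrow> (nat \<Rightarrow> 'w \<Rightarrow> 'x) \<Rightarrow> ('x \<Rightarrow> ereal) \<Rightarrow> bool" where
  "large_deviation_principle M T Z I \<longleftrightarrow>
     Hausdorff_space T \<and> regular_space T \<and>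
     (\<forall>n\<ge>1. Z n \<in> M \<rightarrow>\<^sub>M borel_of T) \<and>
     (\<forall>x\<in>topspace T. 0 \<le> I x) \<and> lower_semicontinuous_in T I \<and>
     (\<forall>V. openin T V \<longrightarrow>
        - (INF x\<in>V. I x)
          \<le> liminf (\<lambda>n. ereal (1 / real n) * ext_log (emeasure (distr M (borel_of T) (Z n)) V))) \<and>
     (\<forall>F. closedin T F \<longrightarrow>
        limsup (\<lambda>n. ereal (1 / real n) * ext_log (emeasure (distr M (borel_of T) (Z n)) F))
          \<le> - (INF x\<in>F. I x))"

definition proper_rate :: "'x topology \<Rightarrow> ('x \<Rightarrow> ereal) \<Rightarrow> bool" where
  "proper_rate T I \<longleftrightarrow> (\<forall>\<alpha>::real. 0 \<le> \<alpha> \<longrightarrow> compactin T {x \<in> topspace T. I x \<le> ereal \<alpha>})"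

text \<open>
  The library's \<^const>\<open>convex_on\<close> only covers real-valued functions. Note that
  \<open>0 * \<infinity> = 0\<close> in \<^typ>\<open>ereal\<close>; the notion is meant for functions that avoid \<open>-\<infinity>\<close>.
\<close>

definition ereal_convex_on :: "'x::real_vector set \<Rightarrow> ('x \<Rightarrow> ereal) \<Rightarrow> bool" where
  "ereal_convex_on C I \<longleftrightarrow> convex C \<and>
     (\<forall>x\<in>C. \<forall>y\<in>C. \<forall>u\<ge>0. \<forall>v\<ge>0. u + v = 1 \<longrightarrow>
        I (u *\<^sub>R x + v *\<^sub>R y) \<le> ereal u * I x + ereal v * I y)"

text \<open>
  The limiting logarithmic moment generating function of \<open>(L n / n)\<close>, expressed through the
  unnormalised variables \<open>L n\<close>. The expectation of the nonnegative variable \<open>exp (z * L n)\<close>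
  is taken in \<open>[0, \<infinity>]\<close>.
\<close>

definition limiting_log_mgf :: "'w measure \<Rightarrow> (nat \<Rightarrow> 'w \<Rightarrow> real) \<Rightarrow> real \<Rightarrow> ereal" where
  "limiting_log_mgf M L z =
     limsup (\<lambda>n. ereal (1 / real n) * ext_log (\<integral>\<^sup>+\<omega>. ennreal (exp (z * L n \<omega>)) \<partial>M))"

definition fenchel_legendre :: "(real \<Rightarrow> ereal) \<Rightarrow> real \<Rightarrow> ereal" where
  "fenchel_legendre \<Lambda> x = (SUP z. ereal (z * x) - \<Lambda> z)"

end

theory Submission
  imports Defs
begin

text \<open>
  Let \<open>L\<^sub>n\<close> be the word length of the walk at time \<open>n\<close>. The proof rests on an almost additivity
  property of its law: there is \<open>c > 0\<close> such that
  \<open>c P(|L\<^sub>n - a| \<le> v) P(|L\<^sub>k - b| \<le> w) \<le> P(|L\<^bsub>n+k\<^esub> - (a + b)| \<le> v + w + 2)\<close>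
  for all times \<open>n, k\<close> (\<open>law_concat\<close>, \<open>walk_almost_additive\<close>). A trajectory of \<open>n\<close> steps and one of
  \<open>k\<close> steps are joined into one whose length is, up to 1, the sum of the two lengths.
  If the support of \<open>\<mu>\<close> is not of the form \<open>{s, s\<^sup>-\<^sup>1}\<close> or \<open>{s, s\<^sup>-\<^sup>1, e}\<close> with \<open>s\<close> a generator, then
  cancellation at the junction can be prevented at bounded cost: two reduced words over the
  support cancel only if the first ends in a letter \<open>x\<close>, the second starts with \<open>x\<^sup>-\<^sup>1\<close>, and both
  letters lie in the support, so the support contains a letter \<open>b\<close> different from \<open>x\<close> and
  \<open>x\<^sup>-\<^sup>1\<close>; inserting \<open>b\<close> keeps the product reduced (\<open>insertion\<close>). In the remaining case the walk
  lives on the integers, and mirroring a trajectory that ends on the less likely side does not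
  decrease its probability, so both trajectories may be taken to end on the same side
  (\<open>law_concat_cyclic\<close>).

  Almost additivity yields the large deviation principle by a subadditivity argument. Call a
  pair \<open>(x, t)\<close> attainable if for every \<open>\<epsilon> > 0\<close> and all large \<open>n\<close> the probability that \<open>L\<^sub>n / n\<close> is
  within \<open>\<epsilon>\<close> of \<open>x\<close> is at least \<open>exp (-n (t + \<epsilon>))\<close>. The attainable pairs form a closed convex
  subset of the plane (\<open>attainable_closed\<close>, \<open>attainable_convex\<close>). By repeating a single favourable
  value many times, every limit of pairs \<open>(k/n, -log P(L\<^sub>n = k)/n)\<close> with \<open>n \<rightarrow> \<infinity>\<close> is attainable
  (\<open>attainable_limit\<close>), even if the limit is taken along a sparse sequence of times. Since \<open>L\<^sub>n\<close> takes
  at most \<open>n + 1\<close> values, the exponential moment \<open>E[exp (z L\<^sub>n)]\<close> is dominated by a single value, and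
  hence for each \<open>z\<close> some attainable pair satisfies \<open>z x - t \<ge> \<Lambda>(z)\<close> (\<open>attainable_tilt\<close>). If \<open>I\<close> is the
  Fenchel-Legendre transform of \<open>\<Lambda>\<close> and \<open>(x, I(x))\<close> were not attainable, a separating line
  would contradict this (\<open>rate_attainable\<close>). So \<open>I\<close> gives the lower bound; the upper bound is the usual
  exponential Chebyshev inequality together with compactness of \<open>[0, 1]\<close>.
\<close>

section \<open>Large deviations for almost additive processes\<close>

lemma space_borel_of: "space (borel_of T) = topspace T"
  by (simp add: borel_of_def space_measure_of_conv)

lemma openin_borel_of:
  assumes "openin T V"
  shows "V \<in> sets (borel_of T)"
proof -
  have "{V. openin T V} \<subseteq> Pow (topspace T)" using openin_subset by auto
  then show ?thesis
    using assms by (simp add: borel_of_def sets_measure_of sigma_sets.Basic)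
qed

lemma closedin_borel_of:
  assumes "closedin T F"
  shows "F \<in> sets (borel_of T)"
proof -
  have "topspace T - F \<in> sets (borel_of T)" using assms by (intro openin_borel_of) auto
  then have "topspace T - (topspace T - F) \<in> sets (borel_of T)"
    using sets.compl_sets[of "topspace T - F" "borel_of T"] by (simp add: space_borel_of)
  then show ?thesis using closedin_subset[OF assms] by (simp add: double_diff)
qed

lemma ln_le_iff_le_exp: "0 < x \<Longrightarrow> ln x \<le> a \<longleftrightarrow> x \<le> exp a" for x a :: real
  by (metis exp_le_cancel_iff exp_ln)

definition window_prob :: "'w measure \<Rightarrow> (nat \<Rightarrow> 'w \<Rightarrow> nat) \<Rightarrow> nat \<Rightarrow> real \<Rightarrow> real \<Rightarrow> real" where
  "window_prob M L n a w = measure M {\<omega> \<in> space M. \<bar>real (L n \<omega>) - a\<bar> \<le> w}"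

text \<open>
  The word length enters only through these axioms: increments of size at most 1, and a
  supermultiplicativity of the window probabilities in which the times add up exactly while the
  windows may grow by a constant. Exactness in time is what makes the property easy to iterate.
\<close>

locale almost_additive = prob_space M for M :: "'w measure" +
  fixes L :: "nat \<Rightarrow> 'w \<Rightarrow> nat" and c C :: real
  assumes L_measurable [measurable]: "\<And>n. L n \<in> M \<rightarrow>\<^sub>M count_space UNIV"
    and L_zero: "\<And>\<omega>. \<omega> \<in> space M \<Longrightarrow> L 0 \<omega> = 0"
    and L_step: "\<And>n. AE \<omega> in M. \<bar>real (L (Suc n) \<omega>) - real (L n \<omega>)\<bar> \<le> 1"
    and c_pos: "0 < c" and C_nonneg: "0 \<le> C"
    and concat_le: "\<And>n m a b v w. c * window_prob M L n a v * window_prob M L m b w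
                   \<le> window_prob M L (n + m) (a + b) (v + w + C)"
begin

abbreviation Q where "Q \<equiv> window_prob M L"

lemma L_shift: "AE \<omega> in M. \<bar>real (L (n + r) \<omega>) - real (L n \<omega>)\<bar> \<le> real r"
proof (induction r)
  case (Suc r)
  from Suc.IH L_step[of "n + r"] show ?case by eventually_elim auto
qed auto

lemma L_le: "AE \<omega> in M. real (L n \<omega>) \<le> real n"
  using L_shift[of 0 n] AE_space by eventually_elim (auto simp: L_zero)

lemma window_measurable [measurable]: "{\<omega> \<in> space M. \<bar>real (L n \<omega>) - a\<bar> \<le> w} \<in> sets M"
  by measurable

text \<open>
  Windows may be moved to a later time, because the process changes by at most 1 in each step.
\<close>

lemma Q_shift:
  assumes "\<bar>a' - a\<bar> + w + real r \<le> w'"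
  shows "Q n a w \<le> Q (n + r) a' w'"
  unfolding window_prob_def
proof (rule finite_measure_mono_AE)
  show "AE \<omega> in M. \<omega> \<in> {\<omega> \<in> space M. \<bar>real (L n \<omega>) - a\<bar> \<le> w} \<longrightarrow>
      \<omega> \<in> {\<omega> \<in> space M. \<bar>real (L (n + r) \<omega>) - a'\<bar> \<le> w'}"
    using L_shift[of n r] by eventually_elim (use assms in auto)
qed measurable

lemma Q_le_1: "Q n a w \<le> 1" and Q_nonneg: "0 \<le> Q n a w"
  unfolding window_prob_def by auto

lemma Q_power: "(c * Q n a w) ^ s \<le> Q (s * n) (real s * a) (real s * (w + C))"
proof (induction s)
  case 0
  have "{\<omega> \<in> space M. \<bar>real (L 0 \<omega>) - 0\<bar> \<le> 0} = space M" by (auto simp: L_zero)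
  then show ?case by (simp add: window_prob_def prob_space)
next
  case (Suc s)
  have "(c * Q n a w) ^ Suc s \<le> c * Q n a w * Q (s * n) (real s * a) (real s * (w + C))"
    using Suc.IH c_pos Q_nonneg by (simp add: mult_left_mono)
  also have "\<dots> \<le> Q (n + s * n) (a + real s * a) (w + real s * (w + C) + C)"
    by (rule concat_le)
  also have "\<dots> = Q (Suc s * n) (real (Suc s) * a) (real (Suc s) * (w + C))"
    by (simp add: algebra_simps)
  finally show ?case .
qed

text \<open>
  This will turn out to contain the graph of the rate function wherever that is finite. The bounds are
  required at all large times, so that membership controls a lower limit of probabilities
  and not merely an upper one.
\<close>

definition attainable :: "(real \<times> real) set" where
  "attainable = {(x, t). \<forall>\<epsilon>>0. \<forall>\<^sub>F n in sequentially.
          exp (- (real n * (t + \<epsilon>))) \<le> Q n (real n * x) (\<epsilon> * real n)}"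

lemma attainable_nonneg:
  assumes "(x, t) \<in> attainable"
  shows "0 \<le> t"
proof (rule ccontr)
  assume "\<not> 0 \<le> t"
  define \<epsilon> where "\<epsilon> = - t / 2"
  have "\<epsilon> > 0" using \<open>\<not> 0 \<le> t\<close> by (simp add: \<epsilon>_def)
  have "\<forall>\<^sub>F n in sequentially. exp (- (real n * (t + \<epsilon>))) \<le> Q n (real n * x) (\<epsilon> * real n)"
    using assms \<open>\<epsilon> > 0\<close> by (auto simp: attainable_def)
  then have "\<forall>\<^sub>F n in sequentially. False"
    using eventually_gt_at_top[of 0]
  proof eventually_elim
    case (elim n)
    have "real n * (t + \<epsilon>) < 0"
      using elim \<open>\<not> 0 \<le> t\<close> by (auto simp: \<epsilon>_def mult_less_0_iff)
    then have "1 < exp (- (real n * (t + \<epsilon>)))" by simp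
    with elim Q_le_1[of n "real n * x" "\<epsilon> * real n"] show False by linarith
  qed
  then show False by simp
qed

lemma attainable_upward:
  assumes "(x, t) \<in> attainable" "t \<le> t'"
  shows "(x, t') \<in> attainable"
  unfolding attainable_def
proof safe
  fix \<epsilon> :: real assume "\<epsilon> > 0"
  have "\<forall>\<^sub>F n in sequentially. exp (- (real n * (t + \<epsilon>))) \<le> Q n (real n * x) (\<epsilon> * real n)"
    using assms \<open>\<epsilon> > 0\<close> by (auto simp: attainable_def)
  then show "\<forall>\<^sub>F n in sequentially. exp (- (real n * (t' + \<epsilon>))) \<le> Q n (real n * x) (\<epsilon> * real n)"
  proof eventually_elim
    case (elim n)
    have "real n * (t + \<epsilon>) \<le> real n * (t' + \<epsilon>)" using assms by (intro mult_left_mono) auto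
    then show ?case using elim by (meson exp_le_cancel_iff neg_le_iff_le order_trans)
  qed
qed

lemma attainable_closed: "closed attainable"
  unfolding closure_subset_eq[symmetric]
proof safe
  fix x t assume "(x, t) \<in> closure attainable"
  then have approx: "\<forall>e>0. \<exists>y\<in>attainable. dist y (x, t) < e" by (simp add: closure_approachable)
  show "(x, t) \<in> attainable"
    unfolding attainable_def
  proof safe
    fix \<epsilon> :: real assume "\<epsilon> > 0"
    then obtain x' t' where att: "(x', t') \<in> attainable" and d: "dist (x', t') (x, t) < \<epsilon> / 2"
      using approx by (metis half_gt_zero surj_pair)
    have dx: "\<bar>x' - x\<bar> < \<epsilon> / 2" using d dist_fst_le[of "(x', t')" "(x, t)"] by (simp add: dist_real_def)
    have dt: "\<bar>t' - t\<bar> < \<epsilon> / 2" using d dist_snd_le[of "(x', t')" "(x, t)"] by (simp add: dist_real_def)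
    have "\<forall>\<^sub>F n in sequentially.
        exp (- (real n * (t' + \<epsilon> / 2))) \<le> Q n (real n * x') (\<epsilon> / 2 * real n)"
      using att \<open>\<epsilon> > 0\<close> unfolding attainable_def by (auto dest!: spec[where x = "\<epsilon> / 2"])
    then show "\<forall>\<^sub>F n in sequentially. exp (- (real n * (t + \<epsilon>))) \<le> Q n (real n * x) (\<epsilon> * real n)"
    proof eventually_elim
      case (elim n)
      have "t' + \<epsilon> / 2 \<le> t + \<epsilon>" using dt by linarith
      then have "real n * (t' + \<epsilon> / 2) \<le> real n * (t + \<epsilon>)" by (intro mult_left_mono) auto
      then have "exp (- (real n * (t + \<epsilon>))) \<le> exp (- (real n * (t' + \<epsilon> / 2)))" by simp
      also note elim
      also have "Q n (real n * x') (\<epsilon> / 2 * real n) \<le> Q (n + 0) (real n * x) (\<epsilon> * real n)"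
      proof (rule Q_shift)
        have "\<bar>real n * x - real n * x'\<bar> = real n * \<bar>x' - x\<bar>"
          by (simp add: abs_mult abs_minus_commute flip: right_diff_distrib)
        also have "\<dots> \<le> real n * (\<epsilon> / 2)" using dx by (intro mult_left_mono) auto
        finally show "\<bar>real n * x - real n * x'\<bar> + \<epsilon> / 2 * real n + real 0 \<le> \<epsilon> * real n"
          by (simp add: algebra_simps)
      qed
      finally show ?case by simp
    qed
  qed
qed

text \<open>
  Spend the fraction \<open>1 - u\<close> of the time at speed \<open>x\<close> and the rest at speed \<open>y\<close>: the speeds and the
  costs both average, and the constants lost in one concatenation are absorbed by \<open>\<epsilon> n\<close>.
\<close>

lemma attainable_convex: "convex attainable"
  unfolding convex_alt
proof (intro ballI allI impI)
  fix p q :: "real \<times> real" and u :: real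
  assume pq: "p \<in> attainable" "q \<in> attainable" and u: "0 \<le> u \<and> u \<le> 1"
  obtain x t y s where [simp]: "p = (x, t)" "q = (y, s)" by (meson surj_pair)
  show "(1 - u) *\<^sub>R p + u *\<^sub>R q \<in> attainable"
  proof (cases "u = 0 \<or> u = 1")
    case True then show ?thesis using pq by auto
  next
    case False
    with u have u: "0 < u" "u < 1" by auto
    \<comment> \<open>The first \<open>n - m n\<close> steps are made at speed \<open>x\<close>, the other \<open>m n\<close> steps at speed \<open>y\<close>.\<close>
    define m where "m n = nat \<lfloor>u * real n\<rfloor>" for n :: nat
    have m_le: "real (m n) \<le> u * real n" for n using u by (simp add: m_def)
    have m_ge: "u * real n - 1 \<le> real (m n)" for n using u by (simp add: m_def)
    have m_n: "m n \<le> n" for n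
      using m_le[of n] u mult_right_mono[of u 1 "real n"] by auto
    have lim_m: "filterlim m sequentially sequentially"
    proof -
      have "filterlim (\<lambda>n. u * real n) at_top sequentially"
        using u by (intro filterlim_tendsto_pos_mult_at_top[OF tendsto_const])
          (auto simp: filterlim_real_sequentially)
      then have "filterlim (\<lambda>n. - 1 + u * real n) at_top sequentially"
        by (rule filterlim_tendsto_add_at_top[OF tendsto_const])
      then have "filterlim (\<lambda>n. real (m n)) at_top sequentially"
        by (rule filterlim_at_top_mono) (use m_ge in \<open>auto simp: algebra_simps\<close>)
      then show ?thesis by (simp add: filterlim_sequentially_iff_filterlim_real)
    qed
    have lim_nm: "filterlim (\<lambda>n. n - m n) sequentially sequentially"
    proof -
      have "filterlim (\<lambda>n. (1 - u) * real n) at_top sequentially"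
        using u by (intro filterlim_tendsto_pos_mult_at_top[OF tendsto_const])
          (auto simp: filterlim_real_sequentially)
      then have "filterlim (\<lambda>n. real (n - m n)) at_top sequentially"
        by (rule filterlim_at_top_mono) (use m_le m_n in \<open>auto simp: algebra_simps of_nat_diff\<close>)
      then show ?thesis by (simp add: filterlim_sequentially_iff_filterlim_real)
    qed
    have "((1 - u) * x + u * y, (1 - u) * t + u * s) \<in> attainable"
      unfolding attainable_def
    proof safe
      fix \<epsilon> :: real assume "\<epsilon> > 0"
      define \<delta> where "\<delta> = \<epsilon> / 4"
      have "\<delta> > 0" using \<open>\<epsilon> > 0\<close> by (simp add: \<delta>_def)
      have "\<forall>\<^sub>F n in sequentially. exp (- (real n * (t + \<delta>))) \<le> Q n (real n * x) (\<delta> * real n)"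
        using pq \<open>\<delta> > 0\<close> unfolding attainable_def by auto
      from eventually_compose_filterlim[OF this lim_nm]
      have e1: "\<forall>\<^sub>F n in sequentially. exp (- (real (n - m n) * (t + \<delta>)))
          \<le> Q (n - m n) (real (n - m n) * x) (\<delta> * real (n - m n))" .
      have "\<forall>\<^sub>F n in sequentially. exp (- (real n * (s + \<delta>))) \<le> Q n (real n * y) (\<delta> * real n)"
        using pq \<open>\<delta> > 0\<close> unfolding attainable_def by auto
      from eventually_compose_filterlim[OF this lim_m]
      have e2: "\<forall>\<^sub>F n in sequentially. exp (- (real (m n) * (s + \<delta>)))
          \<le> Q (m n) (real (m n) * y) (\<delta> * real (m n))" .
      define B where "B = \<bar>t\<bar> + \<bar>s\<bar> + \<bar>x\<bar> + \<bar>y\<bar> + C + \<bar>ln c\<bar>"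
      have e3: "\<forall>\<^sub>F n in sequentially. B / \<delta> \<le> real n"
        using filterlim_real_sequentially unfolding filterlim_at_top by blast
      show "\<forall>\<^sub>F n in sequentially. exp (- (real n * ((1 - u) * t + u * s + \<epsilon>)))
          \<le> Q n (real n * ((1 - u) * x + u * y)) (\<epsilon> * real n)"
        using e1 e2 e3
      proof eventually_elim
        case (elim n)
        define d where "d = u * real n - real (m n)"
        have d: "0 \<le> d" "d \<le> 1" using m_le[of n] m_ge[of n] by (auto simp: d_def)
        have mn: "real (m n) = u * real n - d" by (simp add: d_def)
        have nm: "real (n - m n) = (1 - u) * real n + d"
          using m_n[of n] by (simp add: d_def of_nat_diff algebra_simps)
        have B: "B \<le> \<delta> * real n" using elim(3) \<open>\<delta> > 0\<close> by (simp add: field_simps)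
        have bd: "\<bar>d * z\<bar> \<le> \<bar>z\<bar>" for z
          using d mult_right_mono[of d 1 "\<bar>z\<bar>"] by (simp add: abs_mult)
        have "exp (- (real n * ((1 - u) * t + u * s + \<epsilon>)))
            \<le> exp (ln c + - (real (n - m n) * (t + \<delta>)) + - (real (m n) * (s + \<delta>)))"
        proof (subst exp_le_cancel_iff)
          have "real (n - m n) * (t + \<delta>) + real (m n) * (s + \<delta>)
              = real n * ((1 - u) * t + u * s) + \<delta> * real n + (d * t - d * s)"
            unfolding mn nm by (simp add: algebra_simps)
          also have "\<dots> \<le> real n * ((1 - u) * t + u * s) + \<delta> * real n + (\<bar>t\<bar> + \<bar>s\<bar>)"
            using bd[of t] bd[of s] by linarith
          also have "\<dots> - ln c \<le> real n * ((1 - u) * t + u * s) + \<delta> * real n + B"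
            using C_nonneg by (simp add: B_def)
          also have "\<dots> \<le> real n * ((1 - u) * t + u * s) + \<epsilon> * real n"
          proof -
            have "\<epsilon> * real n = 4 * (\<delta> * real n)" "0 \<le> \<delta> * real n" using \<open>\<delta> > 0\<close> by (auto simp: \<delta>_def)
            then show ?thesis using B by linarith
          qed
          finally show "- (real n * ((1 - u) * t + u * s + \<epsilon>))
              \<le> ln c + - (real (n - m n) * (t + \<delta>)) + - (real (m n) * (s + \<delta>))"
            by (simp add: algebra_simps)
        qed
        also have "\<dots> = c * exp (- (real (n - m n) * (t + \<delta>))) * exp (- (real (m n) * (s + \<delta>)))"
          using c_pos by (simp only: exp_add exp_ln)
        also have "\<dots> \<le> c * Q (n - m n) (real (n - m n) * x) (\<delta> * real (n - m n))
            * Q (m n) (real (m n) * y) (\<delta> * real (m n))"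
          using elim c_pos Q_nonneg by (intro mult_mono) auto
        also have "\<dots> \<le> Q ((n - m n) + m n) (real (n - m n) * x + real (m n) * y)
            (\<delta> * real (n - m n) + \<delta> * real (m n) + C)"
          by (rule concat_le)
        also have "\<dots> \<le> Q ((n - m n + m n) + 0) (real n * ((1 - u) * x + u * y)) (\<epsilon> * real n)"
        proof (rule Q_shift)
          have "real n * ((1 - u) * x + u * y) - (real (n - m n) * x + real (m n) * y)
              = d * y - d * x"
            unfolding mn nm by (simp add: algebra_simps)
          moreover have "\<delta> * real (n - m n) + \<delta> * real (m n) = \<delta> * real n"
            unfolding mn nm by (simp add: algebra_simps)
          moreover have "\<bar>x\<bar> + \<bar>y\<bar> + C \<le> B" by (simp add: B_def)
          moreover have "\<epsilon> * real n = 4 * (\<delta> * real n)" by (simp add: \<delta>_def)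
          moreover have "0 \<le> \<delta> * real n" using \<open>\<delta> > 0\<close> by simp
          ultimately show "\<bar>real n * ((1 - u) * x + u * y) - (real (n - m n) * x + real (m n) * y)\<bar> +
              (\<delta> * real (n - m n) + \<delta> * real (m n) + C) + real 0 \<le> \<epsilon> * real n"
            using bd[of x] bd[of y] B by linarith
        qed
        finally show ?case using m_n[of n] by simp
      qed
    qed
    then show ?thesis by simp
  qed
qed

text \<open>
  The subadditivity argument. A value \<open>k\<close> that is taken at a single large time \<open>n\<^sub>0\<close> with
  probability \<open>p\<close> can be repeated \<open>n div n\<^sub>0\<close> times. Each repetition costs an extra factor \<open>c\<close> and
  an extra width \<open>C\<close>, that is \<open>ln (1/c) / n\<^sub>0\<close> and \<open>C / n\<^sub>0\<close> per unit of time, which is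
  negligible for large \<open>n\<^sub>0\<close>; the remaining \<open>n mod n\<^sub>0\<close> steps are harmless. This turns
  information along some sequence of times into information at all large times.
\<close>

lemma attainable_limit:
  assumes ns: "filterlim ns sequentially sequentially"
    and Q: "\<And>i. exp (- (real (ns i) * ts i)) \<le> Q (ns i) (real (ns i) * xs i) 0"
    and ts0: "\<And>i. 0 \<le> ts i"
    and xs: "xs \<longlonglongrightarrow> x" and ts: "ts \<longlonglongrightarrow> t"
  shows "(x, t) \<in> attainable"
  unfolding attainable_def
proof safe
  fix \<epsilon> :: real assume "\<epsilon> > 0"
  define \<delta> where "\<delta> = \<epsilon> / 4"
  have "\<delta> > 0" using \<open>\<epsilon> > 0\<close> by (simp add: \<delta>_def)
  have "t \<ge> 0" using ts ts0 by (intro LIMSEQ_le_const[OF ts]) auto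
  have "filterlim (\<lambda>i. real (ns i)) at_top sequentially"
    using ns by (simp add: filterlim_sequentially_iff_filterlim_real)
  then have e1: "\<forall>\<^sub>F i in sequentially. (C + \<bar>ln c\<bar> + \<delta>) / \<delta> \<le> real (ns i)"
    unfolding filterlim_at_top by blast
  have e2: "\<forall>\<^sub>F i in sequentially. dist (xs i) x < \<delta>"
    using tendstoD[OF xs \<open>\<delta> > 0\<close>] .
  have e3: "\<forall>\<^sub>F i in sequentially. dist (ts i) t < \<delta>"
    using tendstoD[OF ts \<open>\<delta> > 0\<close>] .
  obtain i where i: "(C + \<bar>ln c\<bar> + \<delta>) / \<delta> \<le> real (ns i)" "dist (xs i) x < \<delta>" "dist (ts i) t < \<delta>"
    using eventually_happens'[OF sequentially_bot eventually_conj[OF e1 eventually_conj[OF e2 e3]]]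
    by blast
  define n0 where "n0 = ns i"
  have n0: "C + \<bar>ln c\<bar> + \<delta> \<le> \<delta> * real n0"
    using i(1) \<open>\<delta> > 0\<close> by (simp add: n0_def field_simps)
  have n0_pos: "n0 > 0" using n0 C_nonneg \<open>\<delta> > 0\<close> by (cases n0) auto
  have "\<forall>\<^sub>F n in sequentially. real n0 * (\<bar>x\<bar> + 1) / \<delta> \<le> real n"
    using filterlim_real_sequentially unfolding filterlim_at_top by blast
  then show "\<forall>\<^sub>F n in sequentially. exp (- (real n * (t + \<epsilon>))) \<le> Q n (real n * x) (\<epsilon> * real n)"
  proof eventually_elim
    case (elim n)
    define s r where "s = n div n0" and "r = n mod n0"
    have n: "n = s * n0 + r" by (simp add: s_def r_def)
    have rn: "real n = real s * real n0 + real r" by (subst n) simp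
    have r: "r < n0" using n0_pos by (simp add: r_def)
    have sn: "real s * real n0 \<le> real n" using rn by simp
    have el: "real n0 * (\<bar>x\<bar> + 1) \<le> \<delta> * real n" using elim \<open>\<delta> > 0\<close> by (simp add: field_simps)
    have "exp (- (real n * (t + \<epsilon>))) \<le> exp (real s * (ln c - real n0 * ts i))"
    proof (subst exp_le_cancel_iff)
      have "real n0 * ts i \<le> real n0 * (t + \<delta>)"
        using i(3) by (intro mult_left_mono) (auto simp: dist_real_def)
      then have "real n0 * ts i - ln c \<le> real n0 * (t + 2 * \<delta>)"
        using n0 C_nonneg \<open>\<delta> > 0\<close> by (simp add: algebra_simps)
      then have "real s * (real n0 * ts i - ln c) \<le> real s * (real n0 * (t + 2 * \<delta>))"
        by (intro mult_left_mono) auto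
      also have "\<dots> = (real s * real n0) * (t + 2 * \<delta>)" by simp
      also have "\<dots> \<le> real n * (t + 2 * \<delta>)"
        using sn \<open>t \<ge> 0\<close> \<open>\<delta> > 0\<close> by (intro mult_right_mono) auto
      also have "\<dots> \<le> real n * (t + \<epsilon>)"
        using \<open>\<epsilon> > 0\<close> by (intro mult_left_mono) (auto simp: \<delta>_def)
      finally show "- (real n * (t + \<epsilon>)) \<le> real s * (ln c - real n0 * ts i)"
        by (simp add: algebra_simps)
    qed
    also have "\<dots> = (c * exp (- (real n0 * ts i))) ^ s"
      using c_pos by (simp only: exp_of_nat_mult exp_diff exp_minus exp_ln divide_inverse)
    also have "\<dots> \<le> (c * Q n0 (real n0 * xs i) 0) ^ s"
      using Q[of i] c_pos by (intro power_mono mult_left_mono) (auto simp: n0_def)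
    also have "\<dots> \<le> Q (s * n0) (real s * (real n0 * xs i)) (real s * (0 + C))"
      by (rule Q_power)
    also have "\<dots> \<le> Q (s * n0 + r) (real n * x) (\<epsilon> * real n)"
    proof (rule Q_shift)
      have "\<bar>real n * x - real s * (real n0 * xs i)\<bar> = \<bar>(real s * real n0) * (x - xs i) + real r * x\<bar>"
        unfolding rn by (simp add: algebra_simps)
      also have "\<dots> \<le> (real s * real n0) * \<bar>x - xs i\<bar> + real r * \<bar>x\<bar>"
        by (rule order_trans[OF abs_triangle_ineq]) (simp add: abs_mult)
      also have "\<dots> \<le> real n * \<delta> + real n0 * \<bar>x\<bar>"
        using i(2) sn r by (intro add_mono mult_mono) (auto simp: dist_real_def)
      finally have 1: "\<bar>real n * x - real s * (real n0 * xs i)\<bar> \<le> real n * \<delta> + real n0 * \<bar>x\<bar>" .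
      have "C \<le> real n0 * \<delta>" using n0 \<open>\<delta> > 0\<close> by (simp add: algebra_simps)
      then have "real s * C \<le> real s * (real n0 * \<delta>)" by (intro mult_left_mono) auto
      also have "\<dots> \<le> real n * \<delta>" using sn \<open>\<delta> > 0\<close> by (simp flip: mult.assoc)
      finally have 2: "real s * C \<le> real n * \<delta>" .
      have 3: "\<epsilon> * real n = 4 * (real n * \<delta>)" by (simp add: \<delta>_def)
      have 4: "0 \<le> real n * \<delta>" using \<open>\<delta> > 0\<close> by simp
      have 5: "real n0 * \<bar>x\<bar> + real n0 \<le> real n * \<delta>" using el by (simp add: algebra_simps)
      show "\<bar>real n * x - real s * (real n0 * xs i)\<bar> + real s * (0 + C) + real r \<le> \<epsilon> * real n"
        using 1 2 4 5 less_imp_le[OF r, THEN of_nat_mono[where ?'a = real]] unfolding 3 add_0 by linarith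
    qed
    finally show ?case using n by simp
  qed
qed

definition mgf :: "nat \<Rightarrow> real \<Rightarrow> real" where
  "mgf n z = expectation (\<lambda>\<omega>. exp (z * real (L n \<omega>)))"

abbreviation \<Lambda> where "\<Lambda> \<equiv> limiting_log_mgf M (\<lambda>n \<omega>. real (L n \<omega>))"

definition lam :: "real \<Rightarrow> real" where "lam z = real_of_ereal (\<Lambda> z)"

text \<open>
  The process is nonnegative and grows at most linearly; the asymmetric form of the bounds is needed
  to see that \<open>\<Lambda>(z) \<le> z\<close> for \<open>z \<ge> 0\<close>, which forces the rate function to be infinite beyond 1.
\<close>

lemma exp_L_bounds:
  "AE \<omega> in M. exp (min z 0 * real n) \<le> exp (z * real (L n \<omega>)) \<and>
     exp (z * real (L n \<omega>)) \<le> exp (max z 0 * real n)"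
  using L_le[of n]
proof eventually_elim
  case (elim \<omega>)
  show ?case
  proof (cases "0 \<le> z")
    case True then show ?thesis using elim by (auto simp: max_def min_def mult_left_mono)
  next
    case False
    then show ?thesis using elim by (auto simp: max_def min_def mult_left_mono_neg mult_nonpos_nonneg)
  qed
qed

lemma integrable_exp_L: "integrable M (\<lambda>\<omega>. exp (z * real (L n \<omega>)))"
  by (rule integrable_const_bound[where B = "exp (max z 0 * real n)"])
     (use exp_L_bounds[of z n] in \<open>auto elim: eventually_mono\<close>)

lemma mgf_upper: "mgf n z \<le> exp (max z 0 * real n)"
proof -
  have "mgf n z \<le> expectation (\<lambda>_. exp (max z 0 * real n))"
    unfolding mgf_def
    by (rule integral_mono_AE[OF integrable_exp_L])
       (use exp_L_bounds[of z n] in \<open>auto elim: eventually_mono\<close>)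
  then show ?thesis by (simp add: prob_space)
qed

lemma mgf_lower: "exp (min z 0 * real n) \<le> mgf n z"
proof -
  have "expectation (\<lambda>_. exp (min z 0 * real n)) \<le> mgf n z"
    unfolding mgf_def
    by (rule integral_mono_AE[OF _ integrable_exp_L])
       (use exp_L_bounds[of z n] in \<open>auto elim: eventually_mono\<close>)
  then show ?thesis by (simp add: prob_space)
qed

lemma mgf_pos: "0 < mgf n z"
  using mgf_lower[of z n] by (meson exp_gt_zero less_le_trans)

lemma Lambda_eq: "\<Lambda> z = limsup (\<lambda>n. ereal (ln (mgf n z) / real n))"
proof -
  have "ereal (1 / real n) * ext_log (\<integral>\<^sup>+\<omega>. ennreal (exp (z * real (L n \<omega>))) \<partial>M)
      = ereal (ln (mgf n z) / real n)" for n
  proof -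
    have "(\<integral>\<^sup>+\<omega>. ennreal (exp (z * real (L n \<omega>))) \<partial>M) = ennreal (mgf n z)"
      unfolding mgf_def by (rule nn_integral_eq_integral[OF integrable_exp_L]) simp
    then show ?thesis using mgf_pos[of n z] by (simp add: ext_log_def)
  qed
  then show ?thesis by (simp add: limiting_log_mgf_def)
qed

lemma Lambda_lam: "\<Lambda> z = ereal (lam z)"
  and lam_le: "lam z \<le> max z 0"
  and lam_ge: "min z 0 \<le> lam z"
proof -
  have up: "\<Lambda> z \<le> ereal (max z 0)"
    unfolding Lambda_eq
  proof (rule Limsup_bounded, rule eventually_mono[OF eventually_gt_at_top[of 0]])
    fix n :: nat assume "0 < n"
    have "ln (mgf n z) \<le> max z 0 * real n"
      using mgf_upper[of n z] mgf_pos[of n z] by (simp add: ln_le_iff_le_exp)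
    with \<open>0 < n\<close> show "ereal (ln (mgf n z) / real n) \<le> ereal (max z 0)"
      by (simp only: ereal_less_eq pos_divide_le_eq of_nat_0_less_iff)
  qed
  have lo: "ereal (min z 0) \<le> \<Lambda> z"
    unfolding Lambda_eq
  proof (rule order_trans[OF Liminf_bounded Liminf_le_Limsup],
      rule eventually_mono[OF eventually_gt_at_top[of 0]])
    fix n :: nat assume "0 < n"
    have "min z 0 * real n \<le> ln (mgf n z)"
      using mgf_lower[of z n] mgf_pos[of n z] by (simp add: ln_ge_iff)
    with \<open>0 < n\<close> show "ereal (min z 0) \<le> ereal (ln (mgf n z) / real n)"
      by (simp only: ereal_less_eq pos_le_divide_eq of_nat_0_less_iff)
  qed simp
  show eq: "\<Lambda> z = ereal (lam z)"
    using up lo unfolding lam_def by (cases "\<Lambda> z") (auto simp: max_def min_def split: if_splits)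
  show "lam z \<le> max z 0" "min z 0 \<le> lam z" using up lo unfolding eq by (simp_all only: ereal_less_eq)
qed

lemma lam_0: "lam 0 = 0"
  using lam_le[of 0] lam_ge[of 0] by simp

lemma mgf_eventually_le:
  assumes "\<epsilon> > 0"
  shows "\<forall>\<^sub>F n in sequentially. mgf n z \<le> exp (real n * (lam z + \<epsilon>))"
proof -
  have "\<Lambda> z < ereal (lam z + \<epsilon>)" using assms by (simp add: Lambda_lam)
  then have "\<forall>\<^sub>F n in sequentially. ereal (ln (mgf n z) / real n) < ereal (lam z + \<epsilon>)"
    unfolding Lambda_eq by (rule Limsup_lessD)
  then show ?thesis using eventually_gt_at_top[of 0]
  proof eventually_elim
    case (elim n)
    then have "ln (mgf n z) \<le> real n * (lam z + \<epsilon>)" by (simp add: field_simps)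
    then show ?case using mgf_pos[of n z] by (simp add: ln_le_iff_le_exp)
  qed
qed

lemma mgf_frequently_ge:
  assumes "\<epsilon> > 0"
  shows "\<exists>n\<ge>N. 0 < n \<and> exp (real n * (lam z - \<epsilon>)) \<le> mgf n z"
proof (rule ccontr)
  assume neg: "\<not> ?thesis"
  have "limsup (\<lambda>n. ereal (ln (mgf n z) / real n)) \<le> ereal (lam z - \<epsilon>)"
  proof (rule Limsup_bounded, rule eventually_mono[OF eventually_gt_at_top[of N]])
    fix n :: nat assume "N < n"
    with neg have "\<not> exp (real n * (lam z - \<epsilon>)) \<le> mgf n z" by (auto dest: spec[of _ n])
    then have "mgf n z \<le> exp (real n * (lam z - \<epsilon>))" by simp
    then have "ln (mgf n z) \<le> real n * (lam z - \<epsilon>)" using mgf_pos[of n z] by (simp add: ln_le_iff_le_exp)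
    with \<open>N < n\<close> show "ereal (ln (mgf n z) / real n) \<le> ereal (lam z - \<epsilon>)" by (simp add: field_simps)
  qed
  then show False using assms Lambda_lam[of z] by (simp add: Lambda_eq)
qed

lemma mgf_atoms: "mgf n z = (\<Sum>k\<le>n. exp (z * real k) * Q n (real k) 0)"
proof -
  have "mgf n z = expectation (\<lambda>\<omega>. \<Sum>k\<le>n. exp (z * real k) * indicator {\<omega> \<in> space M. \<bar>real (L n \<omega>) - real k\<bar> \<le> 0} \<omega>)"
    unfolding mgf_def
  proof (rule integral_cong_AE)
    show "AE \<omega> in M. exp (z * real (L n \<omega>)) =
        (\<Sum>k\<le>n. exp (z * real k) * indicator {\<omega> \<in> space M. \<bar>real (L n \<omega>) - real k\<bar> \<le> 0} \<omega>)"
      using L_le[of n] AE_space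
    proof eventually_elim
      case (elim \<omega>)
      have "(\<Sum>k\<le>n. exp (z * real k) * indicator {\<omega> \<in> space M. \<bar>real (L n \<omega>) - real k\<bar> \<le> 0} \<omega>)
          = (\<Sum>k\<le>n. if L n \<omega> = k then exp (z * real k) else 0)"
        using elim by (intro sum.cong) (auto simp: indicator_def)
      also have "\<dots> = exp (z * real (L n \<omega>))" using elim by (simp add: sum.delta)
      finally show ?case by simp
    qed
  qed measurable
  also have "\<dots> = (\<Sum>k\<le>n. exp (z * real k) * Q n (real k) 0)"
  proof (subst Bochner_Integration.integral_sum)
    fix k
    have "integrable M (indicator {\<omega> \<in> space M. \<bar>real (L n \<omega>) - real k\<bar> \<le> 0} :: _ \<Rightarrow> real)"
      by (rule integrable_real_indicator) (use window_measurable in \<open>auto simp: less_top[symmetric]\<close>)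
    then show "integrable M (\<lambda>\<omega>. exp (z * real k)
        * indicator {\<omega> \<in> space M. \<bar>real (L n \<omega>) - real k\<bar> \<le> 0} \<omega>)"
      by (rule integrable_mult_right)
  next
    have "expectation (indicator {\<omega> \<in> space M. \<bar>real (L n \<omega>) - real k\<bar> \<le> 0}) = Q n (real k) 0" for k
      unfolding window_prob_def by (rule Bochner_Integration.integral_indicator[THEN trans]) (auto intro: arg_cong[where f = prob])
    then show "(\<Sum>k\<le>n. expectation (\<lambda>\<omega>. exp (z * real k)
        * indicator {\<omega> \<in> space M. \<bar>real (L n \<omega>) - real k\<bar> \<le> 0} \<omega>))
        = (\<Sum>k\<le>n. exp (z * real k) * Q n (real k) 0)"
      by simp
  qed
  finally show ?thesis .
qed

text \<open>
  Among the at most \<open>n + 1\<close> values of \<open>L\<^sub>n\<close>, one contributes the fraction \<open>1 / (n + 1)\<close> of the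
  exponential moment. Along times at which the upper limit \<open>\<Lambda>(z)\<close> is almost reached, these values and
  their exponential costs stay in a compact rectangle, and every limit point of them is attainable.
\<close>

lemma attainable_tilt: "\<exists>(x, t)\<in>attainable. lam z \<le> z * x - t"
proof -
  have "\<exists>n k. Suc i \<le> n \<and> k \<le> n \<and>
      exp (real n * (lam z - 1 / real (Suc i))) \<le> real (n + 1) * (exp (z * real k) * Q n (real k) 0)" for i
  proof -
    obtain n where n: "n \<ge> Suc i" "exp (real n * (lam z - 1 / real (Suc i))) \<le> mgf n z"
      using mgf_frequently_ge[of "1 / real (Suc i)" "Suc i" z] by auto
    have "\<exists>k\<le>n. mgf n z \<le> real (n + 1) * (exp (z * real k) * Q n (real k) 0)"
    proof (rule ccontr)
      assume neg: "\<not> ?thesis"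
      have "mgf n z < (\<Sum>k\<le>n. mgf n z / real (n + 1))"
        unfolding mgf_atoms[of n z]
      proof (rule sum_strict_mono)
        fix k assume "k \<in> {..n}"
        with neg have "real (n + 1) * (exp (z * real k) * Q n (real k) 0) < mgf n z"
          by (meson atMost_iff not_le)
        then show "exp (z * real k) * Q n (real k) 0
            < (\<Sum>k\<le>n. exp (z * real k) * Q n (real k) 0) / real (n + 1)"
          by (simp add: mgf_atoms[symmetric] pos_less_divide_eq mult.commute)
      qed auto
      then show False by simp
    qed
    with n show ?thesis by (meson order_trans)
  qed
  then obtain ns ks where ns: "\<And>i. Suc i \<le> ns i" and ks: "\<And>i. ks i \<le> ns i" and
    big: "\<And>i. exp (real (ns i) * (lam z - 1 / real (Suc i)))
        \<le> real (ns i + 1) * (exp (z * real (ks i)) * Q (ns i) (real (ks i)) 0)"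
    by metis
  define xs ts where "xs i = real (ks i) / real (ns i)"
    and "ts i = - ln (Q (ns i) (real (ks i)) 0) / real (ns i)" for i
  have n_pos: "0 < ns i" for i using ns[of i] by linarith
  have Q_pos: "0 < Q (ns i) (real (ks i)) 0" for i
  proof -
    have "0 < real (ns i + 1) * (exp (z * real (ks i)) * Q (ns i) (real (ks i)) 0)"
      using big[of i] by (meson exp_gt_zero less_le_trans)
    then show ?thesis by (simp add: zero_less_mult_iff)
  qed
  have xs: "0 \<le> xs i" "xs i \<le> 1" for i using ks[of i] n_pos[of i] by (auto simp: xs_def)
  have ts0: "0 \<le> ts i" for i
    using Q_le_1[of "ns i" "real (ks i)" 0] Q_pos[of i] by (auto simp: ts_def intro!: divide_nonpos_nonneg)
  have QE: "exp (- (real (ns i) * ts i)) \<le> Q (ns i) (real (ns i) * xs i) 0" for i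
    using n_pos[of i] Q_pos[of i] by (simp add: ts_def xs_def)
  have ineq: "lam z - 1 / real (Suc i) - ln (real (ns i + 1)) / real (ns i) \<le> z * xs i - ts i" for i
  proof -
    have "real (ns i) * (lam z - 1 / real (Suc i))
        \<le> ln (real (ns i + 1) * (exp (z * real (ks i)) * Q (ns i) (real (ks i)) 0))"
      using big[of i] Q_pos[of i] by (subst ln_ge_iff) auto
    also have "\<dots> = ln (real (ns i + 1)) + (z * real (ks i) + ln (Q (ns i) (real (ks i)) 0))"
      using Q_pos[of i] by (simp add: ln_mult)
    finally have le: "real (ns i) * (lam z - 1 / real (Suc i)) - ln (real (ns i + 1))
        \<le> z * real (ks i) + ln (Q (ns i) (real (ks i)) 0)" by linarith
    have "real (ns i) * (lam z - 1 / real (Suc i) - ln (real (ns i + 1)) / real (ns i))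
        = real (ns i) * (lam z - 1 / real (Suc i)) - ln (real (ns i + 1))"
      using n_pos[of i] by (simp add: right_diff_distrib)
    also note le
    also have "z * real (ks i) + ln (Q (ns i) (real (ks i)) 0) = real (ns i) * (z * xs i - ts i)"
      using n_pos[of i] by (simp add: ts_def xs_def algebra_simps)
    finally show ?thesis using n_pos[of i] by simp
  qed
  have ns_lim: "filterlim ns sequentially sequentially"
    by (rule filterlim_at_top_mono[OF filterlim_Suc]) (use ns in auto)
  have lim: "(\<lambda>i. lam z - 1 / real (Suc i) - ln (real (ns i + 1)) / real (ns i)) \<longlonglongrightarrow> lam z"
  proof -
    have "(\<lambda>n::nat. ln (real (n + 1)) / real n) \<longlonglongrightarrow> 0" by real_asymp
    then have "(\<lambda>i. ln (real (ns i + 1)) / real (ns i)) \<longlonglongrightarrow> 0"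
      using ns_lim by (rule filterlim_compose)
    moreover have "(\<lambda>i::nat. 1 / real (Suc i)) \<longlonglongrightarrow> 0" by real_asymp
    ultimately have "(\<lambda>i. lam z - 1 / real (Suc i) - ln (real (ns i + 1)) / real (ns i))
        \<longlonglongrightarrow> lam z - 0 - 0"
      by (intro tendsto_diff tendsto_const)
    then show ?thesis by simp
  qed
  have ln_le: "ln (real (ns i + 1)) / real (ns i) \<le> 1" for i
    using ln_add_one_self_le_self[of "real (ns i)"] n_pos[of i] by (simp add: add.commute)
  have ts1: "ts i \<le> \<bar>z\<bar> + \<bar>lam z\<bar> + 2" for i
  proof -
    have "z * xs i \<le> \<bar>z\<bar> * 1" using xs[of i] 
      by (intro mult_mono) auto
    moreover have "1 / real (Suc i) \<le> 1" by simp
    ultimately show ?thesis using ineq[of i] ln_le[of i] by linarith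
  qed
  have "seq_compact ({0..1::real} \<times> {0..\<bar>z\<bar> + \<bar>lam z\<bar> + 2})"
    by (intro compact_imp_seq_compact compact_Times compact_Icc)
  moreover have "\<forall>i. (xs i, ts i) \<in> {0..1} \<times> {0..\<bar>z\<bar> + \<bar>lam z\<bar> + 2}"
    using xs ts0 ts1 by auto
  ultimately obtain l \<sigma> where \<sigma>: "strict_mono \<sigma>" and "((\<lambda>i. (xs i, ts i)) \<circ> \<sigma>) \<longlonglongrightarrow> l"
    by (rule seq_compactE)
  then obtain x t where conv: "(\<lambda>i. (xs (\<sigma> i), ts (\<sigma> i))) \<longlonglongrightarrow> (x, t)"
    by (cases l) (auto simp: o_def)
  have x: "(\<lambda>i. xs (\<sigma> i)) \<longlonglongrightarrow> x" and t: "(\<lambda>i. ts (\<sigma> i)) \<longlonglongrightarrow> t"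
    using tendsto_fst[OF conv] tendsto_snd[OF conv] by auto
  have \<sigma>_lim: "filterlim \<sigma> sequentially sequentially" using \<sigma> by (rule filterlim_subseq)
  have "(x, t) \<in> attainable"
    by (rule attainable_limit[where ns = "\<lambda>i. ns (\<sigma> i)", OF _ _ _ x t])
       (use filterlim_compose[OF ns_lim \<sigma>_lim] QE ts0 in auto)
  moreover have "lam z \<le> z * x - t"
  proof (rule LIMSEQ_le)
    show "(\<lambda>i. lam z - 1 / real (Suc (\<sigma> i)) - ln (real (ns (\<sigma> i) + 1)) / real (ns (\<sigma> i))) \<longlonglongrightarrow> lam z"
      using filterlim_compose[OF lim \<sigma>_lim] .
    show "(\<lambda>i. z * xs (\<sigma> i) - ts (\<sigma> i)) \<longlonglongrightarrow> z * x - t"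
      by (intro tendsto_intros x t)
  qed (use ineq in auto)
  ultimately show ?thesis by auto
qed

definition rate :: "real \<Rightarrow> ereal" where "rate = fenchel_legendre \<Lambda>"

lemma rate_eq: "rate x = (SUP z. ereal (z * x - lam z))"
  by (simp add: rate_def fenchel_legendre_def Lambda_lam)

lemma rate_ge: "ereal (z * x - lam z) \<le> rate x"
  unfolding rate_eq by (rule SUP_upper) simp

lemma rate_nonneg: "0 \<le> rate x"
  using rate_ge[of 0 x] by (simp add: lam_0 zero_ereal_def)

text \<open>
  Let \<open>z \<rightarrow> \<infinity>\<close> in \<open>z x - \<Lambda>(z) \<ge> z (x - 1)\<close>, where \<open>z \<ge> 0\<close>.
\<close>

lemma rate_gt_1:
  assumes "x > 1"
  shows "rate x = \<infinity>"
proof (rule ereal_top)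
  fix B :: real
  define z where "z = max 0 (B / (x - 1))"
  have "B \<le> z * (x - 1)" using assms by (simp add: z_def max_def field_simps)
  also have "\<dots> \<le> z * x - lam z" using lam_le[of z] by (simp add: z_def algebra_simps)
  finally show "ereal B \<le> rate x" using rate_ge[of z x] by (meson ereal_less_eq(3) order_trans)
qed

lemma rate_sublevel: "closed {x. rate x \<le> \<alpha>}"
proof -
  have "{x. rate x \<le> \<alpha>} = (\<Inter>z. {x. ereal (z * x - lam z) \<le> \<alpha>})"
    by (auto simp: rate_eq SUP_le_iff)
  also have "closed \<dots>"
  proof (intro closed_INT ballI)
    fix z
    show "closed {x. ereal (z * x - lam z) \<le> \<alpha>}"
      by (intro closed_Collect_le continuous_intros)
  qed
  finally show ?thesis .
qed

lemma rate_convex: "ereal_convex_on {0..} rate"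
  unfolding ereal_convex_on_def
proof (intro conjI ballI allI impI)
  fix x y u v :: real assume uv: "0 \<le> u" "0 \<le> v" "u + v = 1"
  show "rate (u *\<^sub>R x + v *\<^sub>R y) \<le> ereal u * rate x + ereal v * rate y"
    unfolding rate_eq[of "u *\<^sub>R x + v *\<^sub>R y"]
  proof (rule SUP_least)
    fix z
    have "z * (u * x + v * y) - lam z = u * (z * x - lam z) + v * (z * y - lam z)"
      using uv(3) by (simp add: algebra_simps) (metis distrib_left mult.commute mult_1)
    then have "ereal (z * (u *\<^sub>R x + v *\<^sub>R y) - lam z)
        = ereal u * ereal (z * x - lam z) + ereal v * ereal (z * y - lam z)"
      by simp
    also have "\<dots> \<le> ereal u * rate x + ereal v * rate y"
      using uv rate_ge by (intro add_mono ereal_mult_left_mono) auto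
    finally show "ereal (z * (u *\<^sub>R x + v *\<^sub>R y) - lam z) \<le> ereal u * rate x + ereal v * rate y" .
  qed
qed (rule convex_real_interval)

text \<open>
  Otherwise a line separates \<open>(x, t)\<close> strictly from the closed convex set of attainable pairs. If the line
  is not vertical, its slope \<open>z\<close> contradicts \<open>z x - \<Lambda>(z) \<le> t\<close>, because some attainable pair witnesses
  \<open>\<Lambda>(z)\<close>. If it is vertical, then every attainable speed lies on one side of \<open>x\<close>, at a positive
  distance, and tilting strongly towards that side makes \<open>z x - \<Lambda>(z)\<close> arbitrarily large.
\<close>

lemma rate_attainable:
  assumes "rate x = ereal t"
  shows "(x, t) \<in> attainable"
proof (rule ccontr)
  assume "(x, t) \<notin> attainable"
  then obtain a b where ab: "a \<bullet> (x, t) < b" "\<And>p. p \<in> attainable \<Longrightarrow> b < a \<bullet> p"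
    using separating_hyperplane_closed_point[OF attainable_convex attainable_closed] by metis
  obtain u v where [simp]: "a = (u, v)" by (cases a)
  have below: "u * x + v * t < b" using ab(1) by simp
  have above: "b < u * y + v * s" if "(y, s) \<in> attainable" for y s using ab(2)[OF that] by simp
  have legendre: "z * x - lam z \<le> t" for z using rate_ge[of z x] assms by simp
  have v_nonneg: "0 \<le> v"
  proof (rule ccontr)
    assume "\<not> 0 \<le> v"
    obtain y s where att: "(y, s) \<in> attainable" using attainable_tilt[of 0] by auto
    define s' where "s' = max s ((b - u * y) / v)"
    have "(y, s') \<in> attainable" using attainable_upward[OF att] by (simp add: s'_def)
    from above[OF this] have "b - u * y < v * s'" by simp
    moreover have "v * s' \<le> v * ((b - u * y) / v)"
      using \<open>\<not> 0 \<le> v\<close> by (intro mult_left_mono_neg) (auto simp: s'_def)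
    ultimately show False using \<open>\<not> 0 \<le> v\<close> by simp
  qed
  show False
  proof (cases "v = 0")
    case False
    with v_nonneg have v: "v > 0" by simp
    define z where "z = - u / v"
    obtain y s where att: "(y, s) \<in> attainable" and le: "lam z \<le> z * y - s" using attainable_tilt[of z] by auto
    have "u * x + v * t < u * y + v * s" using below above[OF att] by simp
    then have "v * (t - z * x) < v * (s - z * y)" using v by (simp add: z_def algebra_simps)
    then have "t - z * x < s - z * y" using v by simp
    with le legendre[of z] show False by linarith
  next
    case True
    define d where "d = b - u * x"
    have d: "d > 0" using below True by (simp add: d_def)
    have t: "t \<ge> 0" using rate_nonneg[of x] assms by simp
    \<comment> \<open>The tilt is just strong enough for \<open>z x - \<Lambda>(z)\<close> to exceed \<open>t\<close>.\<close>
    define h where "h = (t + 1) / d"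
    have h: "h \<ge> 0" using d t by (simp add: h_def)
    define z where "z = - h * u"
    obtain y s where att: "(y, s) \<in> attainable" and le: "lam z \<le> z * y - s" using attainable_tilt[of z] by auto
    have "b \<le> u * y" using above[OF att] True by simp
    then have "h * d \<le> h * (u * y - u * x)" using h by (intro mult_left_mono) (auto simp: d_def)
    also have "\<dots> = z * x - z * y" by (simp add: z_def algebra_simps)
    also have "\<dots> \<le> z * x - lam z" using le attainable_nonneg[OF att] by simp
    also have "\<dots> \<le> t" by (rule legendre)
    finally show False using d by (simp add: h_def)
  qed
qed

abbreviation Z :: "nat \<Rightarrow> 'w \<Rightarrow> real" where "Z n \<omega> \<equiv> real (L n \<omega>) / real n"

abbreviation logprob :: "nat \<Rightarrow> real set \<Rightarrow> ereal" where
  "logprob n A \<equiv> ereal (1 / real n) * ext_log (emeasure (distr M (borel_of (top_of_set {0..})) (Z n)) A)"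

lemma Z_measurable: "Z n \<in> M \<rightarrow>\<^sub>M borel_of (top_of_set {0..})"
proof -
  have "(\<lambda>k. real k / real n) \<in> count_space UNIV \<rightarrow>\<^sub>M borel_of (top_of_set {0..})"
    by (auto simp: space_borel_of)
  from measurable_compose[OF L_measurable this] show ?thesis .
qed

lemma logprob_eq:
  assumes "A \<in> sets (borel_of (top_of_set {0..}))"
  shows "logprob n A = ereal (1 / real n) * (if prob {\<omega> \<in> space M. Z n \<omega> \<in> A} = 0 then - \<infinity>
           else ereal (ln (prob {\<omega> \<in> space M. Z n \<omega> \<in> A})))"
proof -
  have "emeasure (distr M (borel_of (top_of_set {0..})) (Z n)) A = emeasure M (Z n -` A \<inter> space M)"
    by (rule emeasure_distr[OF Z_measurable assms])
  also have "Z n -` A \<inter> space M = {\<omega> \<in> space M. Z n \<omega> \<in> A}" by auto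
  finally show ?thesis by (simp add: emeasure_eq_measure ext_log_def)
qed

lemma logprob_ge:
  assumes A: "A \<in> sets (borel_of (top_of_set {0..}))" and "0 < n"
    and le: "exp (- (real n * t)) \<le> prob {\<omega> \<in> space M. Z n \<omega> \<in> A}"
  shows "ereal (- t) \<le> logprob n A"
proof -
  define p where "p = prob {\<omega> \<in> space M. Z n \<omega> \<in> A}"
  have p: "0 < p" using le by (simp add: p_def less_le_trans[OF exp_gt_zero])
  have "- (real n * t) \<le> ln p" using le p by (simp add: p_def ln_ge_iff)
  then have "- t \<le> 1 / real n * ln p" using \<open>0 < n\<close> by (simp add: field_simps)
  then show ?thesis using p by (simp add: logprob_eq[OF A] p_def)
qed

lemma logprob_le:
  assumes A: "A \<in> sets (borel_of (top_of_set {0..}))" and "0 < n"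
    and le: "prob {\<omega> \<in> space M. Z n \<omega> \<in> A} \<le> exp (- (real n * t))"
  shows "logprob n A \<le> ereal (- t)"
proof -
  define p where "p = prob {\<omega> \<in> space M. Z n \<omega> \<in> A}"
  show ?thesis
  proof (cases "p = 0")
    case True
    then show ?thesis using \<open>0 < n\<close> by (simp add: logprob_eq[OF A] p_def)
  next
    case False
    then have p: "0 < p" by (simp add: p_def zero_less_measure_iff)
    have "ln p \<le> - (real n * t)" using le p by (simp add: p_def ln_le_iff_le_exp)
    then have "1 / real n * ln p \<le> - t" using \<open>0 < n\<close> by (simp add: field_simps)
    then show ?thesis using p by (simp add: logprob_eq[OF A] p_def)
  qed
qed

lemma lower_bound:
  assumes V: "openin (top_of_set {0..}) V"
  shows "- (INF x\<in>V. rate x) \<le> liminf (\<lambda>n. logprob n V)"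
proof -
  have "- rate x \<le> liminf (\<lambda>n. logprob n V)" if "x \<in> V" for x
  proof (cases "rate x")
    case (real t)
    obtain U where U: "open U" "V = {0..} \<inter> U" using V by (auto simp: openin_open)
    with \<open>x \<in> V\<close> obtain e where e: "e > 0" "ball x e \<subseteq> U" by (meson IntD2 openE)
    have "- ereal t \<le> liminf (\<lambda>n. logprob n V) + ereal d" if "d > 0" for d
    proof -
      define \<epsilon> where "\<epsilon> = min d (e / 2)"
      have \<epsilon>: "\<epsilon> > 0" "\<epsilon> \<le> d" "\<epsilon> < e" using e that by (auto simp: \<epsilon>_def)
      have "\<forall>\<^sub>F n in sequentially. exp (- (real n * (t + \<epsilon>))) \<le> Q n (real n * x) (\<epsilon> * real n)"
        using rate_attainable[OF real] \<epsilon> by (auto simp: attainable_def)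
      then have "\<forall>\<^sub>F n in sequentially. ereal (- (t + \<epsilon>)) \<le> logprob n V"
        using eventually_gt_at_top[of 0]
      proof eventually_elim
        case (elim n)
        show ?case
        proof (rule logprob_ge[OF openin_borel_of[OF V] \<open>0 < n\<close>])
          have "Q n (real n * x) (\<epsilon> * real n) \<le> prob {\<omega> \<in> space M. Z n \<omega> \<in> V}"
            unfolding window_prob_def
          proof (rule finite_measure_mono)
            show "{\<omega> \<in> space M. Z n \<omega> \<in> V} \<in> events"
              using measurable_sets[OF Z_measurable openin_borel_of[OF V], of n]
              by (simp add: vimage_def Int_def conj_commute)
            show "{\<omega> \<in> space M. \<bar>real (L n \<omega>) - real n * x\<bar> \<le> \<epsilon> * real n} \<subseteq> {\<omega> \<in> space M. Z n \<omega> \<in> V}"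
            proof safe
              fix \<omega> assume "\<bar>real (L n \<omega>) - real n * x\<bar> \<le> \<epsilon> * real n"
              moreover have "real (L n \<omega>) - real n * x = real n * (Z n \<omega> - x)"
                using \<open>0 < n\<close> by (simp add: field_simps)
              ultimately have "\<bar>Z n \<omega> - x\<bar> \<le> \<epsilon>"
                using \<open>0 < n\<close> by (simp add: abs_mult mult.commute)
              then have "Z n \<omega> \<in> ball x e" using \<epsilon> by (simp add: dist_real_def abs_minus_commute)
              then show "Z n \<omega> \<in> V" using e U by auto
            qed
          qed
          with elim show "exp (- (real n * (t + \<epsilon>))) \<le> prob {\<omega> \<in> space M. Z n \<omega> \<in> V}" by linarith
        qed
      qed
      then have "ereal (- (t + \<epsilon>)) \<le> liminf (\<lambda>n. logprob n V)" by (rule Liminf_bounded)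
      then have "ereal (- (t + \<epsilon>)) + ereal \<epsilon> \<le> liminf (\<lambda>n. logprob n V) + ereal d"
        using \<epsilon> by (intro add_mono) auto
      then show ?thesis by simp
    qed
    then show ?thesis unfolding real by (rule ereal_le_epsilon2)
  qed (use rate_nonneg[of x] in auto)
  then have "- liminf (\<lambda>n. logprob n V) \<le> (INF x\<in>V. rate x)"
    by (intro INF_greatest) (rule iffD1[OF ereal_uminus_le_reorder], blast)
  then show ?thesis by (rule iffD1[OF ereal_uminus_le_reorder])
qed

lemma prob_half_space:
  assumes "0 < n" "A \<in> events" "\<And>\<omega>. \<omega> \<in> A \<Longrightarrow> s \<le> z * Z n \<omega>"
  shows "prob A \<le> exp (- (real n * s)) * mgf n z"
proof -
  have "prob A = expectation (indicator A)" using assms by simp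
  also have "\<dots> \<le> expectation (\<lambda>\<omega>. exp (- (real n * s)) * exp (z * real (L n \<omega>)))"
  proof (rule integral_mono)
    show "integrable M (indicator A :: _ \<Rightarrow> real)"
      using assms by (intro integrable_real_indicator) (auto simp: less_top[symmetric])
    show "integrable M (\<lambda>\<omega>. exp (- (real n * s)) * exp (z * real (L n \<omega>)))"
      by (intro integrable_mult_right integrable_exp_L)
    show "indicator A \<omega> \<le> exp (- (real n * s)) * exp (z * real (L n \<omega>))" for \<omega>
    proof (cases "\<omega> \<in> A")
      case True
      then have "real n * s \<le> z * real (L n \<omega>)"
        using assms(1) assms(3)[OF True] by (simp add: field_simps)
      then show ?thesis using True by (simp flip: exp_add)
    qed simp
  qed
  also have "\<dots> = exp (- (real n * s)) * mgf n z" by (simp add: mgf_def)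
  finally show ?thesis .
qed

text \<open>
  Exponential Chebyshev inequality with a parameter \<open>z\<close> for which \<open>z x - \<Lambda>(z)\<close> exceeds \<open>\<alpha>\<close>; on
  a small ball the linear function \<open>z y\<close> hardly differs from \<open>z x\<close>.
\<close>

lemma local_upper_bound:
  assumes "ereal \<alpha> < rate x"
  shows "\<exists>e>0. \<forall>\<^sub>F n in sequentially.
           prob {\<omega> \<in> space M. Z n \<omega> \<in> ball x e} \<le> exp (- (real n * \<alpha>))"
proof -
  obtain z where z: "\<alpha> < z * x - lam z"
    using assms unfolding rate_eq by (auto simp: less_SUP_iff)
  define d where "d = (z * x - lam z - \<alpha>) / 2"
  have d: "d > 0" using z by (simp add: d_def)
  define e where "e = d / (\<bar>z\<bar> + 1)"
  have e: "e > 0" using d by (simp add: e_def)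
  have ze: "\<bar>z\<bar> * e \<le> d" using d by (simp add: e_def field_simps)
  have "\<forall>\<^sub>F n in sequentially. prob {\<omega> \<in> space M. Z n \<omega> \<in> ball x e} \<le> exp (- (real n * \<alpha>))"
    using mgf_eventually_le[OF d, of z] eventually_gt_at_top[of 0]
  proof eventually_elim
    case (elim n)
    have "prob {\<omega> \<in> space M. Z n \<omega> \<in> ball x e} \<le> exp (- (real n * (z * x - d))) * mgf n z"
    proof (rule prob_half_space[OF \<open>0 < n\<close>])
      show "{\<omega> \<in> space M. Z n \<omega> \<in> ball x e} \<in> events" by measurable
      fix \<omega> assume "\<omega> \<in> {\<omega> \<in> space M. Z n \<omega> \<in> ball x e}"
      then have "\<bar>z * (x - Z n \<omega>)\<bar> \<le> \<bar>z\<bar> * e" by (auto simp: abs_mult dist_real_def intro!: mult_left_mono)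
      then have "\<bar>z * (x - Z n \<omega>)\<bar> \<le> d" using ze by linarith
      then show "z * x - d \<le> z * Z n \<omega>" by (simp add: algebra_simps abs_le_iff)
    qed
    also have "\<dots> \<le> exp (- (real n * (z * x - d))) * exp (real n * (lam z + d))"
      using elim by (intro mult_left_mono) auto
    also have "\<dots> = exp (- (real n * (z * x - lam z - 2 * d)))"
      by (simp add: algebra_simps flip: exp_add)
    also have "z * x - lam z - 2 * d = \<alpha>" by (simp add: d_def field_simps)
    finally show ?case .
  qed
  with e show ?thesis by blast
qed

lemma upper_bound:
  assumes F: "closedin (top_of_set {0..}) F"
  shows "limsup (\<lambda>n. logprob n F) \<le> - (INF x\<in>F. rate x)"
proof -
  have F_sets: "F \<in> sets (borel_of (top_of_set {0..}))" by (rule closedin_borel_of[OF F])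
  have F_events: "{\<omega> \<in> space M. Z n \<omega> \<in> F} \<in> events" for n
    using measurable_sets[OF Z_measurable F_sets, of n] by (simp add: vimage_def Int_def conj_commute)
  have "closed F" using F closed_atLeast closedin_closed_trans by blast
  then have comp: "compact (F \<inter> {0..1})" by (intro closed_Int_compact) auto
  have le: "limsup (\<lambda>n. logprob n F) \<le> ereal (- \<alpha>)" if \<alpha>: "ereal \<alpha> < (INF x\<in>F. rate x)" for \<alpha>
  proof -
    \<comment> \<open>The gap between \<open>\<alpha>\<close> and \<open>\<beta>\<close> absorbs the number of balls in the cover.\<close>
    obtain \<beta> where \<beta>: "\<alpha> < \<beta>" "ereal \<beta> < (INF x\<in>F. rate x)"
      using ereal_dense2[OF \<alpha>] by auto
    have "\<exists>e>0. \<forall>\<^sub>F n in sequentially.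
        prob {\<omega> \<in> space M. Z n \<omega> \<in> ball x e} \<le> exp (- (real n * \<beta>))" if "x \<in> F" for x
      using \<beta>(2) that by (intro local_upper_bound) (meson INF_lower less_le_trans)
    then have "\<forall>x\<in>F. \<exists>e>0. \<forall>\<^sub>F n in sequentially.
        prob {\<omega> \<in> space M. Z n \<omega> \<in> ball x e} \<le> exp (- (real n * \<beta>))"
      by blast
    then obtain e where "\<forall>x\<in>F. e x > 0 \<and> (\<forall>\<^sub>F n in sequentially.
        prob {\<omega> \<in> space M. Z n \<omega> \<in> ball x (e x)} \<le> exp (- (real n * \<beta>)))"
      unfolding bchoice_iff ..
    then have e: "\<And>x. x \<in> F \<Longrightarrow> e x > 0"
      "\<And>x. x \<in> F \<Longrightarrow> \<forall>\<^sub>F n in sequentially.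
        prob {\<omega> \<in> space M. Z n \<omega> \<in> ball x (e x)} \<le> exp (- (real n * \<beta>))"
      by auto
    obtain D where D: "D \<subseteq> F \<inter> {0..1}" "finite D" "F \<inter> {0..1} \<subseteq> (\<Union>x\<in>D. ball x (e x))"
    proof (rule compactE_image[OF comp, of "F \<inter> {0..1}" "\<lambda>x. ball x (e x)"])
      show "F \<inter> {0..1} \<subseteq> (\<Union>x\<in>F \<inter> {0..1}. ball x (e x))"
        using e(1) by (intro subsetI UN_I) auto
    qed auto
    have ev: "\<forall>\<^sub>F n in sequentially. \<forall>x\<in>D.
        prob {\<omega> \<in> space M. Z n \<omega> \<in> ball x (e x)} \<le> exp (- (real n * \<beta>))"
      using D e(2) by (intro eventually_ball_finite) auto
    have "filterlim (\<lambda>n. (\<beta> - \<alpha>) * real n) at_top sequentially"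
      using \<beta> by (intro filterlim_tendsto_pos_mult_at_top[OF tendsto_const])
        (auto simp: filterlim_real_sequentially)
    then have big: "\<forall>\<^sub>F n in sequentially. ln (real (card D) + 1) \<le> (\<beta> - \<alpha>) * real n"
      unfolding filterlim_at_top by blast
    show ?thesis
    proof (rule Limsup_bounded)
      show "\<forall>\<^sub>F n in sequentially. logprob n F \<le> ereal (- \<alpha>)"
        using ev big eventually_gt_at_top[of 0]
      proof eventually_elim
        case (elim n)
        show ?case
        proof (rule logprob_le[OF F_sets \<open>0 < n\<close>])
          have "prob {\<omega> \<in> space M. Z n \<omega> \<in> F} \<le> prob (\<Union>x\<in>D. {\<omega> \<in> space M. Z n \<omega> \<in> ball x (e x)})"
          proof (rule finite_measure_mono_AE)
            show "AE \<omega> in M. \<omega> \<in> {\<omega> \<in> space M. Z n \<omega> \<in> F} \<longrightarrow>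
                \<omega> \<in> (\<Union>x\<in>D. {\<omega> \<in> space M. Z n \<omega> \<in> ball x (e x)})"
              using L_le[of n] AE_space
            proof eventually_elim
              case (elim \<omega>)
              have "Z n \<omega> \<in> {0..1}" using elim \<open>0 < n\<close> by simp
              then show ?case using D(3) elim(2) by blast
            qed
            show "(\<Union>x\<in>D. {\<omega> \<in> space M. Z n \<omega> \<in> ball x (e x)}) \<in> events"
              using D(2) by (intro sets.finite_UN) measurable
          qed
          also have "\<dots> \<le> (\<Sum>x\<in>D. prob {\<omega> \<in> space M. Z n \<omega> \<in> ball x (e x)})"
            by (rule finite_measure_subadditive_finite[OF D(2)]) auto
          also have "\<dots> \<le> (\<Sum>x\<in>D. exp (- (real n * \<beta>)))"
            using elim(1) by (intro sum_mono) auto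
          also have "\<dots> \<le> (real (card D) + 1) * exp (- (real n * \<beta>))"
            by simp
          also have "\<dots> = exp (ln (real (card D) + 1) - real n * \<beta>)"
            by (simp add: exp_diff exp_minus field_simps)
          also have "\<dots> \<le> exp (- (real n * \<alpha>))"
            using elim(2) by (simp add: algebra_simps)
          finally show "prob {\<omega> \<in> space M. Z n \<omega> \<in> F} \<le> exp (- (real n * \<alpha>))" .
        qed
      qed
    qed
  qed
  show ?thesis
  proof (rule ccontr)
    assume "\<not> ?thesis"
    then have "- (INF x\<in>F. rate x) < limsup (\<lambda>n. logprob n F)" by (simp only: not_le)
    then have "- limsup (\<lambda>n. logprob n F) < (INF x\<in>F. rate x)"
      by (rule iffD1[OF ereal_uminus_less_reorder])
    then obtain \<alpha> where \<alpha>: "- limsup (\<lambda>n. logprob n F) < ereal \<alpha>" "ereal \<alpha> < (INF x\<in>F. rate x)"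
      using ereal_dense2 by blast
    from le[OF \<alpha>(2)] \<alpha>(1) show False
      by (cases "limsup (\<lambda>n. logprob n F)") auto
  qed
qed

theorem ldp:
  "large_deviation_principle M (top_of_set {0..}) Z rate \<and> proper_rate (top_of_set {0..}) rate \<and>
   ereal_convex_on {0..} rate"
proof (intro conjI)
  have sub: "closedin (top_of_set {0..}) {x \<in> {0..}. rate x \<le> \<alpha>}" for \<alpha>
    using closedin_closed_Int[OF rate_sublevel[of \<alpha>], of "{0..}"] by (simp add: Int_def)
  show "large_deviation_principle M (top_of_set {0..}) Z rate"
    unfolding large_deviation_principle_def lower_semicontinuous_in_def
    using lower_bound upper_bound rate_nonneg Z_measurable sub
    by (auto intro: Hausdorff_space_subtopology regular_space_subtopology
        simp: regular_space_euclidean)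
  show "proper_rate (top_of_set {0..}) rate"
    unfolding proper_rate_def
  proof (intro allI impI)
    fix \<alpha> :: real
    have "x \<le> 1" if "rate x \<le> ereal \<alpha>" for x using rate_gt_1[of x] that by (cases "x \<le> 1") auto
    then have "{x \<in> {0..}. rate x \<le> ereal \<alpha>} = {0..1} \<inter> {x. rate x \<le> ereal \<alpha>}" by auto
    then have "compact {x \<in> {0..}. rate x \<le> ereal \<alpha>}"
      using rate_sublevel[of "ereal \<alpha>"] by (simp add: compact_Int_closed)
    then show "compactin (top_of_set {0..}) {x \<in> topspace (top_of_set {0..}). rate x \<le> ereal \<alpha>}"
      by (auto simp: compactin_subtopology)
  qed
qed (rule rate_convex)

end

section \<open>Word length in free groups\<close>

locale free_group_basis = group G for G (structure) +
  fixes S :: "'a set"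
  assumes free: "free_generators G S"
begin

abbreviation wp :: "'a list \<Rightarrow> 'a" where "wp \<equiv> word_product G"

abbreviation val :: "('a \<times> bool) list \<Rightarrow> 'a" where "val u \<equiv> wp (map (letter_value G) u)"

abbreviation len :: "'a \<Rightarrow> nat" where "len \<equiv> word_length G S"

definition flip_letter :: "'a \<times> bool \<Rightarrow> 'a \<times> bool" where "flip_letter l = (fst l, \<not> snd l)"

lemma wp_simps [simp]: "wp [] = \<one>" "wp (g # gs) = g \<otimes> wp gs"
  by (simp_all add: word_product_def)

lemma wp_closed [simp, intro]: "set gs \<subseteq> carrier G \<Longrightarrow> wp gs \<in> carrier G"
  by (induction gs) auto

lemma wp_append:
  "set gs \<subseteq> carrier G \<Longrightarrow> set hs \<subseteq> carrier G \<Longrightarrow> wp (gs @ hs) = wp gs \<otimes> wp hs"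
  by (induction gs) (auto simp: m_assoc)

lemma S_carrier: "S \<subseteq> carrier G" and generate_S: "generate G S = carrier G"
  and relation_free: "set u \<subseteq> S \<times> UNIV \<Longrightarrow> reduced_word u \<Longrightarrow> u \<noteq> [] \<Longrightarrow> val u \<noteq> \<one>"
  using free unfolding free_generators_def by auto

lemma letter_closed [simp]: "l \<in> S \<times> UNIV \<Longrightarrow> letter_value G l \<in> carrier G"
  using S_carrier by (auto simp: letter_value_def)

lemma letters_closed: "set u \<subseteq> S \<times> UNIV \<Longrightarrow> set (map (letter_value G) u) \<subseteq> carrier G"
  by (auto simp del: mem_Times_iff)

lemma val_closed: "set u \<subseteq> S \<times> UNIV \<Longrightarrow> val u \<in> carrier G"
  using letters_closed by blast

lemma val_append:
  "set u \<subseteq> S \<times> UNIV \<Longrightarrow> set v \<subseteq> S \<times> UNIV \<Longrightarrow> val (u @ v) = val u \<otimes> val v"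
  using letters_closed by (simp add: wp_append)

lemma flip_letter_simps [simp]:
  "fst (flip_letter l) = fst l" "snd (flip_letter l) = (\<not> snd l)" "flip_letter (flip_letter l) = l"
  by (auto simp: flip_letter_def)

lemma flip_letter_in: "l \<in> S \<times> UNIV \<Longrightarrow> flip_letter l \<in> S \<times> UNIV"
  by (auto simp: flip_letter_def)

lemma letter_value_flip: "l \<in> S \<times> UNIV \<Longrightarrow> letter_value G (flip_letter l) = inv letter_value G l"
  using S_carrier by (auto simp: letter_value_def flip_letter_def)

lemma reduced_Cons: "reduced_word (l # u) \<longleftrightarrow> u = [] \<or> hd u \<noteq> flip_letter l \<and> reduced_word u"
  by (auto simp: reduced_word_def successively_Cons flip_letter_def prod_eq_iff)

lemma reduced_append: "reduced_word (u @ v) \<longleftrightarrow>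
    reduced_word u \<and> reduced_word v \<and> (u = [] \<or> v = [] \<or> hd v \<noteq> flip_letter (last u))"
  by (auto simp: reduced_word_def successively_append_iff flip_letter_def prod_eq_iff)

lemma reduced_Nil [simp]: "reduced_word []"
  by (simp add: reduced_word_def)

text \<open>
  Cancelling only deletes letters, so the reduced word uses no new letter; in this way the letters stay
  in the support of the step distribution.
\<close>

lemma exists_reduced:
  assumes "set u \<subseteq> S \<times> UNIV"
  shows "\<exists>v. reduced_word v \<and> set v \<subseteq> set u \<and> length v \<le> length u \<and> val v = val u"
  using assms
proof (induction u)
  case (Cons l u)
  then obtain v where v: "reduced_word v" "set v \<subseteq> set u" "length v \<le> length u" "val v = val u"
    by auto
  have l: "l \<in> S \<times> UNIV" and u: "set u \<subseteq> S \<times> UNIV" using Cons.prems by auto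
  show ?case
  proof (cases "v \<noteq> [] \<and> hd v = flip_letter l")
    case False
    then show ?thesis using v by (intro exI[of _ "l # v"]) (auto simp: reduced_Cons)
  next
    case True
    then obtain v' where v': "v = flip_letter l # v'" by (metis list.collapse)
    have v'_in: "set v' \<subseteq> S \<times> UNIV" using v v' u by auto
    have "val (l # u) = letter_value G l \<otimes> (inv letter_value G l \<otimes> val v')"
      using v(4) v' l by (simp add: letter_value_flip flip: v(4))
    also have "\<dots> = val v'"
      using l val_closed[OF v'_in] by (simp add: m_assoc[symmetric] del: mem_Times_iff)
    finally have "val v' = val (l # u)" by simp
    then show ?thesis using v v' by (intro exI[of _ v']) (auto simp: reduced_Cons)
  qed
qed auto

text \<open>
  After removal of a common prefix, the inverse of the first word followed by the second is reduced
  and evaluates to the identity, so it must be empty.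
\<close>

lemma reduced_unique:
  assumes "set u \<subseteq> S \<times> UNIV" "set v \<subseteq> S \<times> UNIV" "reduced_word u" "reduced_word v" "val u = val v"
  shows "u = v"
  using assms
proof (induction u arbitrary: v)
  case Nil
  then show ?case using relation_free[of v] by auto
next
  case (Cons l u)
  show ?case
  proof (cases v)
    case Nil
    then show ?thesis using relation_free[of "l # u"] Cons.prems by auto
  next
    case v: (Cons l' v')
    have in_S: "l \<in> S \<times> UNIV" "l' \<in> S \<times> UNIV" "set u \<subseteq> S \<times> UNIV" "set v' \<subseteq> S \<times> UNIV"
      using Cons.prems v by auto
    have red: "reduced_word u" "reduced_word v'" using Cons.prems v by (auto simp: reduced_Cons)
    show ?thesis
    proof (cases "l = l'")
      case True
      have "letter_value G l \<otimes> val u = letter_value G l \<otimes> val v'"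
        using Cons.prems(5) v True by simp
      then have "val u = val v'" using in_S val_closed by (simp del: mem_Times_iff)
      then show ?thesis using Cons.IH[of v'] in_S red True v by simp
    next
      case False
      define w where "w = rev (map flip_letter (l # u)) @ v"
      have inv_val: "val (rev (map flip_letter x)) = inv val x" if "set x \<subseteq> S \<times> UNIV" for x
        using that
      proof (induction x)
        case (Cons y x)
        have "set (rev (map flip_letter x)) \<subseteq> S \<times> UNIV"
          using Cons.prems by (fastforce simp: flip_letter_def)
        moreover have "y \<in> S \<times> UNIV" "set x \<subseteq> S \<times> UNIV" using Cons.prems by auto
        ultimately show ?case
          using Cons.IH val_closed[of x] val_append[of "rev (map flip_letter x)" "[flip_letter y]"]
            flip_letter_in[of y]
          by (simp add: letter_value_flip inv_mult_group del: mem_Times_iff)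
      qed simp
      have flips: "set (rev (map flip_letter (l # u))) \<subseteq> S \<times> UNIV"
        using Cons.prems(1) by (fastforce simp: flip_letter_def)
      then have w_in: "set w \<subseteq> S \<times> UNIV"
        using Cons.prems(2) unfolding w_def set_append by (rule Un_least)
      have inv_red: "reduced_word (rev (map flip_letter x))" if "reduced_word x" for x
        using that unfolding reduced_word_def successively_rev successively_map
        by (rule successively_mono) (auto simp: flip_letter_def)
      have "reduced_word w"
        unfolding w_def reduced_append
        using inv_red[OF Cons.prems(3)] Cons.prems(4) False v by simp
      moreover have "val w = \<one>"
      proof -
        have "val w = inv val (l # u) \<otimes> val v"
          unfolding w_def val_append[OF flips Cons.prems(2)] inv_val[OF Cons.prems(1)] ..
        then show ?thesis using Cons.prems(5) val_closed[OF Cons.prems(2)] by (simp add: l_inv)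
      qed
      moreover have "w \<noteq> []" by (simp add: w_def)
      ultimately show ?thesis using relation_free[OF w_in] by blast
    qed
  qed
qed

lemma exists_letter:
  assumes "g \<in> S \<union> m_inv G ` S"
  obtains l where "l \<in> S \<times> UNIV" "letter_value G l = g"
proof -
  from assms have "g \<in> S \<or> (\<exists>s\<in>S. g = inv s)" by auto
  then show thesis
  proof
    assume "g \<in> S"
    then show thesis by (intro that[of "(g, True)"]) (auto simp: letter_value_def)
  next
    assume "\<exists>s\<in>S. g = inv s"
    then obtain s where "s \<in> S" "g = inv s" by blast
    then show thesis by (intro that[of "(s, False)"]) (auto simp: letter_value_def)
  qed
qed

lemma length_list_letters:
  assumes "set gs \<subseteq> S \<union> m_inv G ` S"
  shows "\<exists>u. set u \<subseteq> S \<times> UNIV \<and> length u = length gs \<and> map (letter_value G) u = gs"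
  using assms
proof (induction gs)
  case (Cons g gs)
  then obtain u where u: "set u \<subseteq> S \<times> UNIV" "length u = length gs" "map (letter_value G) u = gs"
    by auto
  from Cons.prems have "g \<in> S \<union> m_inv G ` S" by simp
  then obtain l where "l \<in> S \<times> UNIV" "letter_value G l = g" by (rule exists_letter)
  with u show ?case by (intro exI[of _ "l # u"]) auto
qed auto

text \<open>
  Any shorter representation would reduce to a reduced word with the same value, which can only
  be \<open>u\<close> itself.
\<close>

lemma len_reduced:
  assumes u: "set u \<subseteq> S \<times> UNIV" "reduced_word u"
  shows "len (val u) = length u"
  unfolding word_length_def
proof (rule Least_equality)
  have "set (map (letter_value G) u) \<subseteq> S \<union> m_inv G ` S"
    using u(1) by (auto simp: letter_value_def)
  then show "\<exists>gs. length gs = length u \<and> set gs \<subseteq> S \<union> m_inv G ` S \<and> val u = wp gs"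
    by (intro exI[of _ "map (letter_value G) u"]) auto
next
  fix n assume "\<exists>gs. length gs = n \<and> set gs \<subseteq> S \<union> m_inv G ` S \<and> val u = wp gs"
  then obtain gs where gs: "length gs = n" "set gs \<subseteq> S \<union> m_inv G ` S" "val u = wp gs" by blast
  obtain v where v: "set v \<subseteq> S \<times> UNIV" "length v = n" "val v = val u"
    using length_list_letters[OF gs(2)] gs by auto
  obtain v' where v': "reduced_word v'" "set v' \<subseteq> set v" "length v' \<le> length v" "val v' = val v"
    using exists_reduced[OF v(1)] by blast
  have "u = v'" using reduced_unique[of u v'] u v v' by auto
  then show "length u \<le> n" using v v' by simp
qed

lemma reduced_word_over:
  assumes T: "T \<subseteq> S \<union> m_inv G ` S \<union> {\<one>}" and w: "set w \<subseteq> T"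
  shows "\<exists>u. reduced_word u \<and> set u \<subseteq> S \<times> UNIV \<and> letter_value G ` set u \<subseteq> T \<and> val u = wp w"
proof -
  have T_closed: "T \<subseteq> carrier G" using T S_carrier by auto
  have drop_one: "wp (filter (\<lambda>g. g \<noteq> \<one>) gs) = wp gs" if "set gs \<subseteq> carrier G" for gs
    using that by (induction gs) auto
  have "set (filter (\<lambda>g. g \<noteq> \<one>) w) \<subseteq> S \<union> m_inv G ` S" using w T by auto
  then obtain u where u: "set u \<subseteq> S \<times> UNIV" "map (letter_value G) u = filter (\<lambda>g. g \<noteq> \<one>) w"
    using length_list_letters by blast
  obtain v where v: "reduced_word v" "set v \<subseteq> set u" "val v = val u"
    using exists_reduced[OF u(1)] by blast
  have "letter_value G ` set v \<subseteq> set (map (letter_value G) u)" using v(2) by auto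
  also have "\<dots> \<subseteq> T" using u(2) w by auto
  finally show ?thesis
    using v u drop_one[of w] w T_closed by (intro exI[of _ v]) auto
qed

text \<open>
  A cancellation at the junction involves a letter and its inverse, both of which then belong to \<open>T\<close>.
  Hence \<open>T\<close> contains a further letter, which belongs to a different generator and separates the two words.
\<close>

lemma insertion:
  assumes T: "T \<subseteq> S \<union> m_inv G ` S \<union> {\<one>}"
    and not_cyclic: "\<not> (\<exists>s\<in>S. s \<in> T \<and> inv s \<in> T \<and> T \<subseteq> {s, inv s, \<one>})"
    and w: "set w \<subseteq> T" and v: "set v \<subseteq> T"
  shows "\<exists>f\<in>insert [] ((\<lambda>b. [b]) ` T).
           \<bar>real (len (wp (w @ f @ v))) - (real (len (wp w)) + real (len (wp v)))\<bar> \<le> 1"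
proof -
  have T_closed: "T \<subseteq> carrier G" using T S_carrier by auto
  obtain w' where w': "reduced_word w'" "set w' \<subseteq> S \<times> UNIV" "letter_value G ` set w' \<subseteq> T" "val w' = wp w"
    using reduced_word_over[OF T w] by blast
  obtain v' where v': "reduced_word v'" "set v' \<subseteq> S \<times> UNIV" "letter_value G ` set v' \<subseteq> T" "val v' = wp v"
    using reduced_word_over[OF T v] by blast
  have lens: "len (wp w) = length w'" "len (wp v) = length v'"
    using len_reduced w' v' by metis+
  show ?thesis
  proof (cases "reduced_word (w' @ v')")
    case True
    have "len (wp (w @ [] @ v)) = len (val (w' @ v'))"
      using w v T_closed w' v' by (simp add: wp_append[of w v] val_append[OF w'(2) v'(2)] del: map_append)
    also have "\<dots> = length w' + length v'" using len_reduced[of "w' @ v'"] True w' v' by simp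
    finally show ?thesis using lens by (intro bexI[of _ "[]"]) auto
  next
    case False
    then have ne: "w' \<noteq> []" "v' \<noteq> []" and cancel: "hd v' = flip_letter (last w')"
      using w' v' by (auto simp: reduced_append)
    define l where "l = last w'"
    have l: "l \<in> set w'" "flip_letter l \<in> set v'" using ne cancel by (auto simp: l_def intro: list.set_sel(1) simp flip: cancel)
    then have l_in: "l \<in> S \<times> UNIV" "letter_value G l \<in> T" "inv letter_value G l \<in> T"
      using w' v' letter_value_flip[of l] by (auto 0 3 simp: image_subset_iff)
    define s where "s = fst l"
    have s: "s \<in> S" "s \<in> T" "inv s \<in> T"
      using l_in S_carrier by (auto simp: s_def letter_value_def split: if_splits)
    then obtain b where b: "b \<in> T" "b \<notin> {s, inv s, \<one>}" using not_cyclic by blast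
    then have "b \<in> S \<union> m_inv G ` S" using T by auto
    then obtain l' where l': "l' \<in> S \<times> UNIV" "letter_value G l' = b" by (rule exists_letter)
    have "fst l' \<noteq> s" using l'(2) b by (auto simp: letter_value_def split: if_splits)
    then have apart: "l' \<noteq> flip_letter l" "hd v' \<noteq> flip_letter l'"
      using cancel by (auto simp: s_def flip_letter_def l_def prod_eq_iff)
    define x where "x = w' @ [l'] @ v'"
    have x_in: "set x \<subseteq> S \<times> UNIV" using w' v' l' by (auto simp: x_def)
    have x_red: "reduced_word x"
      using w' v' ne apart by (auto simp: x_def reduced_append reduced_Cons l_def)
    have "wp (w @ [b] @ v) = wp w \<otimes> (b \<otimes> wp v)"
      using w v b T_closed by (subst wp_append) auto
    also have "\<dots> = val x"
      unfolding x_def using w' v' l' by (subst val_append) (auto simp del: map_append)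
    finally have "len (wp (w @ [b] @ v)) = length w' + length v' + 1"
      using len_reduced[OF x_in x_red] by (simp add: x_def)
    then show ?thesis using lens b by (intro bexI[of _ "[b]"]) auto
  qed
qed

lemma exists_reduced_word:
  assumes "g \<in> carrier G"
  shows "\<exists>u. reduced_word u \<and> set u \<subseteq> S \<times> UNIV \<and> val u = g"
proof -
  have "g \<in> generate G S" using assms generate_S by simp
  then have "\<exists>u. set u \<subseteq> S \<times> UNIV \<and> val u = g"
  proof induction
    case one
    show ?case by (intro exI[of _ "[]"]) auto
  next
    case (incl h)
    then show ?case using S_carrier by (intro exI[of _ "[(h, True)]"]) (auto simp: letter_value_def)
  next
    case (inv h)
    then show ?case using S_carrier by (intro exI[of _ "[(h, False)]"]) (auto simp: letter_value_def)
  next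
    case (eng h1 h2)
    then obtain u v where "set u \<subseteq> S \<times> UNIV" "val u = h1" "set v \<subseteq> S \<times> UNIV" "val v = h2" by blast
    then show ?case by (intro exI[of _ "u @ v"]) (auto simp: val_append simp del: map_append)
  qed
  then obtain u where u: "set u \<subseteq> S \<times> UNIV" "val u = g" by blast
  obtain v where "reduced_word v" "set v \<subseteq> set u" "val v = val u"
    using exists_reduced[OF u(1)] by blast
  with u show ?thesis by (intro exI[of _ v]) auto
qed

lemma len_mult_le:
  assumes g: "g \<in> carrier G" and t: "t \<in> S \<union> m_inv G ` S \<union> {\<one>}"
  shows "len (g \<otimes> t) \<le> len g + 1"
proof (cases "t = \<one>")
  case True
  then show ?thesis using g by simp
next
  case False
  then have "t \<in> S \<union> m_inv G ` S" using t by auto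
  then obtain l where l: "l \<in> S \<times> UNIV" "letter_value G l = t" by (rule exists_letter)
  define v where "v = [l]"
  have v: "set v \<subseteq> S \<times> UNIV" "length v = 1" "map (letter_value G) v = [t]"
    using l by (auto simp: v_def)
  obtain u where u: "reduced_word u" "set u \<subseteq> S \<times> UNIV" "val u = g"
    using exists_reduced_word[OF g] by blast
  have uv: "set (u @ v) \<subseteq> S \<times> UNIV" using u v by simp
  obtain x where x: "reduced_word x" "set x \<subseteq> set (u @ v)" "length x \<le> length (u @ v)" "val x = val (u @ v)"
    using exists_reduced[OF uv] by blast
  have "t \<in> carrier G" using t S_carrier by auto
  then have "val (u @ v) = g \<otimes> t" using u v by (simp add: val_append del: map_append)
  then have "len (g \<otimes> t) = length x" "len g = length u"
    using len_reduced[of x] len_reduced[of u] x u uv by auto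
  then show ?thesis using x(3) v(2) by simp
qed

lemma len_mult_generator:
  assumes g: "g \<in> carrier G" and t: "t \<in> S \<union> m_inv G ` S \<union> {\<one>}"
  shows "\<bar>real (len (g \<otimes> t)) - real (len g)\<bar> \<le> 1"
proof -
  have t_closed: "t \<in> carrier G" using t S_carrier by auto
  have "inv t \<in> S \<union> m_inv G ` S \<union> {\<one>}" using t S_carrier by auto
  then have "len (g \<otimes> t \<otimes> inv t) \<le> len (g \<otimes> t) + 1" using g t_closed by (intro len_mult_le) auto
  moreover have "g \<otimes> t \<otimes> inv t = g" using g t_closed by (simp add: m_assoc)
  ultimately show ?thesis using len_mult_le[OF g t] by simp
qed

lemma len_int_pow:
  assumes l: "l \<in> S \<times> UNIV"
  shows "len (letter_value G l [^] (k::int)) = nat \<bar>k\<bar>"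
proof -
  have rep: "val (replicate n l') = letter_value G l' [^] n" if "l' \<in> S \<times> UNIV" for l' and n :: nat
  proof (induction n)
    case (Suc n)
    then show ?case using that nat_pow_Suc2[of "letter_value G l'" n] by (simp del: mem_Times_iff)
  qed simp
  have red: "reduced_word (replicate n l')" for l' :: "'a \<times> bool" and n :: nat
  proof (induction n)
    case (Suc n)
    then show ?case
      by (simp only: replicate_Suc reduced_Cons) (cases n, auto simp: flip_letter_def prod_eq_iff)
  qed simp
  have pow: "len (letter_value G l' [^] n) = n" if "l' \<in> S \<times> UNIV" for l' and n :: nat
  proof -
    have "set (replicate n l') \<subseteq> S \<times> UNIV" using that by auto
    from len_reduced[OF this red] show ?thesis by (simp only: rep[OF that] length_replicate)
  qed
  show ?thesis
  proof (cases k rule: int_cases2)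
    case (nonneg n)
    then show ?thesis using pow[OF l, of n] by (simp only: int_pow_int abs_of_nat nat_int)
  next
    case (nonpos n)
    have "letter_value G l [^] k = inv (letter_value G l [^] n)"
      unfolding nonpos by (rule int_pow_neg_int[OF letter_closed[OF l]])
    also have "\<dots> = letter_value G (flip_letter l) [^] n"
      by (simp only: letter_value_flip[OF l] nat_pow_inv[OF letter_closed[OF l]])
    finally show ?thesis
      using pow[OF flip_letter_in[OF l], of n] by (simp only: nonpos abs_minus abs_of_nat nat_int)
  qed
qed

end

section \<open>Almost additivity of the law of the word length\<close>

text \<open>
  Here \<open>T\<close> is the support of the step distribution and \<open>m\<close> gives the masses of its points. As \<open>T\<close> is
  finite, the law of the word length is a finite sum over words of steps.
\<close>

locale weighted_steps = free_group_basis G S for G (structure) and S :: "'a set" +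
  fixes T :: "'a set" and m :: "'a \<Rightarrow> real"
  assumes T_sub: "T \<subseteq> S \<union> m_inv G ` S \<union> {\<one>}"
    and T_finite: "finite T"
    and m_pos: "\<And>t. t \<in> T \<Longrightarrow> 0 < m t"
begin

definition words :: "nat \<Rightarrow> 'a list set" where
  "words n = {w. set w \<subseteq> T \<and> length w = n}"

definition weight :: "'a list \<Rightarrow> real" where
  "weight w = prod_list (map m w)"

definition window_words :: "nat \<Rightarrow> real \<Rightarrow> real \<Rightarrow> 'a list set" where
  "window_words n a v = {w \<in> words n. \<bar>real (len (wp w)) - a\<bar> \<le> v}"

definition law :: "nat \<Rightarrow> real \<Rightarrow> real \<Rightarrow> real" where
  "law n a v = (\<Sum>w\<in>window_words n a v. weight w)"

lemma T_closed: "T \<subseteq> carrier G"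
  using T_sub S_carrier by auto

lemma finite_words [simp]: "finite (words n)"
  unfolding words_def using finite_lists_length_eq[OF T_finite] by (simp add: conj_commute)

lemma finite_window_words [simp]: "finite (window_words n a v)"
  by (rule finite_subset[OF _ finite_words[of n]]) (auto simp: window_words_def)

lemma weight_simps [simp]: "weight [] = 1" "weight (t # w) = m t * weight w"
  "weight (u @ v) = weight u * weight v"
  by (simp_all add: weight_def)

lemma weight_pos: "set w \<subseteq> T \<Longrightarrow> 0 < weight w"
  by (induction w) (auto simp: m_pos)

lemma weight_nonneg: "w \<in> words n \<Longrightarrow> 0 \<le> weight w"
  using weight_pos by (auto simp: words_def less_imp_le)

lemma law_nonneg: "0 \<le> law n a v"
  unfolding law_def by (intro sum_nonneg) (auto simp: window_words_def intro: weight_nonneg)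

text \<open>
  Transport of weight: if each pair of words can be sent, by one of finitely many injective maps, to a
  word that carries at least the weight \<open>c\<close> times the product and has nearly the right length,
  then the product of the two laws is bounded by the sum of the target laws. Each map is
  injective, so no target word is counted twice for the same map.
\<close>

lemma law_product_le:
  fixes \<phi> :: "'j \<Rightarrow> 'a list \<Rightarrow> 'a list \<Rightarrow> 'a list" and d :: "'j \<Rightarrow> nat"
  assumes J: "finite J"
    and maps: "\<And>j w v. j \<in> J \<Longrightarrow> w \<in> words n \<Longrightarrow> v \<in> words k \<Longrightarrow> \<phi> j w v \<in> words (n + k + d j)"
    and inj: "\<And>j. j \<in> J \<Longrightarrow> inj_on (\<lambda>(w, v). \<phi> j w v) (words n \<times> words k)"
    and choice: "\<And>w v. w \<in> words n \<Longrightarrow> v \<in> words k \<Longrightarrow> \<exists>j\<in>J. c * weight w * weight v \<le> weight (\<phi> j w v) \<and>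
        \<bar>real (len (wp (\<phi> j w v))) - (real (len (wp w)) + real (len (wp v)))\<bar> \<le> 1"
  shows "c * law n a x * law k b y \<le> (\<Sum>j\<in>J. law (n + k + d j) (a + b) (x + y + 1))"
proof -
  define P where "P = window_words n a x \<times> window_words k b y"
  define D where "D j = window_words (n + k + d j) (a + b) (x + y + 1)" for j
  define \<psi> where "\<psi> j = (\<lambda>(w, v). \<phi> j w v)" for j
  have P_sub: "P \<subseteq> words n \<times> words k" by (auto simp: P_def window_words_def)
  have P_fin: "finite P" by (simp add: P_def)
  have "c * law n a x * law k b y = (\<Sum>p\<in>P. c * weight (fst p) * weight (snd p))"
  proof -
    have "law n a x * law k b y = (\<Sum>p\<in>P. weight (fst p) * weight (snd p))"
      unfolding law_def P_def by (simp only: sum_product sum.cartesian_product case_prod_beta')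
    then show ?thesis by (simp add: mult.assoc flip: sum_distrib_left)
  qed
  also have "\<dots> \<le> (\<Sum>p\<in>P. \<Sum>j\<in>J. if \<psi> j p \<in> D j then weight (\<psi> j p) else 0)"
  proof (rule sum_mono)
    fix p assume "p \<in> P"
    then obtain w v where p: "p = (w, v)" "w \<in> window_words n a x" "v \<in> window_words k b y"
      by (auto simp: P_def)
    then have wv: "w \<in> words n" "v \<in> words k" by (auto simp: window_words_def)
    obtain j where j: "j \<in> J" "c * weight w * weight v \<le> weight (\<phi> j w v)"
      "\<bar>real (len (wp (\<phi> j w v))) - (real (len (wp w)) + real (len (wp v)))\<bar> \<le> 1"
      using choice[OF wv] by blast
    have "\<psi> j p \<in> D j"
      using j(3) p maps[OF j(1) wv] by (auto simp: D_def \<psi>_def window_words_def)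
    then have "c * weight (fst p) * weight (snd p) \<le> (if \<psi> j p \<in> D j then weight (\<psi> j p) else 0)"
      using j(2) p by (simp add: \<psi>_def)
    also have "\<dots> \<le> (\<Sum>j\<in>J. if \<psi> j p \<in> D j then weight (\<psi> j p) else 0)"
      using J j(1) wv p maps
      by (intro member_le_sum) (auto simp: \<psi>_def intro: weight_nonneg)
    finally show "c * weight (fst p) * weight (snd p)
        \<le> (\<Sum>j\<in>J. if \<psi> j p \<in> D j then weight (\<psi> j p) else 0)" .
  qed
  also have "\<dots> = (\<Sum>j\<in>J. \<Sum>p\<in>P. if \<psi> j p \<in> D j then weight (\<psi> j p) else 0)"
    by (rule sum.swap)
  also have "\<dots> \<le> (\<Sum>j\<in>J. law (n + k + d j) (a + b) (x + y + 1))"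
  proof (rule sum_mono)
    fix j assume j: "j \<in> J"
    have inj': "inj_on (\<psi> j) {p \<in> P. \<psi> j p \<in> D j}"
      using inj[OF j] unfolding \<psi>_def by (rule inj_on_subset) (use P_sub in auto)
    have "(\<Sum>p\<in>P. if \<psi> j p \<in> D j then weight (\<psi> j p) else 0)
        = (\<Sum>p\<in>{p \<in> P. \<psi> j p \<in> D j}. weight (\<psi> j p))"
      using P_fin by (simp add: sum.inter_filter)
    also have "\<dots> = sum weight (\<psi> j ` {p \<in> P. \<psi> j p \<in> D j})"
      by (simp add: sum.reindex[OF inj'])
    also have "\<dots> \<le> sum weight (D j)"
      by (rule sum_mono2) (auto simp: D_def window_words_def intro: weight_nonneg)
    finally show "(\<Sum>p\<in>P. if \<psi> j p \<in> D j then weight (\<psi> j p) else 0)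
        \<le> law (n + k + d j) (a + b) (x + y + 1)"
      by (simp add: law_def D_def)
  qed
  finally show ?thesis .
qed

text \<open>
  The maps that join two words with either nothing or one letter of \<open>T\<close> in between are injective for
  fixed lengths of the two words, and the weight of an inserted letter is at least the least mass of a
  step, a positive constant.
\<close>

lemma law_concat_free:
  assumes not_cyclic: "\<not> (\<exists>s\<in>S. s \<in> T \<and> inv s \<in> T \<and> T \<subseteq> {s, inv s, \<one>})"
  shows "\<exists>c>0. \<forall>n k a b x y. c * law n a x * law k b y
           \<le> law (n + k) (a + b) (x + y + 1) + law (n + k + 1) (a + b) (x + y + 1)"
proof -
  define J where "J = insert [] ((\<lambda>b. [b]) ` T)"
  have J_fin: "finite J" using T_finite by (simp add: J_def)
  have J_len: "length f = 0 \<or> length f = 1" and J_T: "set f \<subseteq> T" if "f \<in> J" for f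
    using that by (auto simp: J_def)
  define c where "c = Min (weight ` J)"
  have c_pos: "0 < c"
    using J_fin weight_pos[OF J_T] by (auto simp: c_def Min_gr_iff J_def)
  have c_le: "c \<le> weight f" if "f \<in> J" for f
    using J_fin that by (simp add: c_def)
  have J_card: "0 < real (card J)" using J_fin by (auto simp: J_def card_gt_0_iff)
  have main: "c / real (card J) * law n a x * law k b y
      \<le> law (n + k) (a + b) (x + y + 1) + law (n + k + 1) (a + b) (x + y + 1)" for n k a b x y
  proof -
    have "c * law n a x * law k b y \<le> (\<Sum>f\<in>J. law (n + k + length f) (a + b) (x + y + 1))"
    proof (rule law_product_le[where \<phi> = "\<lambda>f w v. w @ f @ v", OF J_fin])
      fix f w v assume "f \<in> J" "w \<in> words n" "v \<in> words k"
      then show "w @ f @ v \<in> words (n + k + length f)" using J_T by (auto simp: words_def)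
    next
      fix f show "inj_on (\<lambda>(w, v). w @ f @ v) (words n \<times> words k)"
        by (auto simp: inj_on_def words_def)
    next
      fix w v assume wv: "w \<in> words n" "v \<in> words k"
      then obtain f where f: "f \<in> J"
        "\<bar>real (len (wp (w @ f @ v))) - (real (len (wp w)) + real (len (wp v)))\<bar> \<le> 1"
        using insertion[OF T_sub not_cyclic, of w v] unfolding words_def J_def by blast
      have "c * (weight w * weight v) \<le> weight f * (weight w * weight v)"
        using c_le[OF f(1)] weight_nonneg[OF wv(1)] weight_nonneg[OF wv(2)]
        by (intro mult_right_mono) auto
      then show "\<exists>f\<in>J. c * weight w * weight v \<le> weight (w @ f @ v) \<and>
          \<bar>real (len (wp (w @ f @ v))) - (real (len (wp w)) + real (len (wp v)))\<bar> \<le> 1"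
        using f by (auto simp: algebra_simps intro!: bexI[of _ f])
    qed
    also have "\<dots> \<le> (\<Sum>f\<in>J. law (n + k) (a + b) (x + y + 1) + law (n + k + 1) (a + b) (x + y + 1))"
    proof (rule sum_mono)
      fix f assume "f \<in> J"
      from J_len[OF this] show "law (n + k + length f) (a + b) (x + y + 1)
          \<le> law (n + k) (a + b) (x + y + 1) + law (n + k + 1) (a + b) (x + y + 1)"
        using law_nonneg by auto
    qed
    finally show ?thesis using J_card by (simp add: field_simps)
  qed
  show ?thesis
    using c_pos J_card main by (intro exI[of _ "c / real (card J)"]) auto
qed

text \<open>
  The walk is a nearest neighbour walk on the powers of \<open>a\<close>, with exponent \<open>e w\<close> and length
  \<open>|e w|\<close>. Exchanging \<open>a\<close> with its inverse in a word with negative exponent replaces more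
  factors \<open>m (inv a)\<close> by \<open>m a\<close> than conversely, so the weight does not decrease. After mirroring
  where necessary, both exponents are nonnegative and the lengths add up. There are four choices
  of which words to mirror, hence the factor 4.
\<close>

lemma law_concat_cyclic:
  assumes a: "l \<in> S \<times> UNIV" "a = letter_value G l"
    and T: "a \<in> T" "inv a \<in> T" "T \<subseteq> {a, inv a, \<one>}" and le: "m (inv a) \<le> m a"
  shows "law n x p * law k y q \<le> 4 * law (n + k) (x + y) (p + q + 1)"
proof -
  have a_closed [simp]: "a \<in> carrier G" using a by simp
  have single: "set [l] \<subseteq> S \<times> UNIV" "set [flip_letter l] \<subseteq> S \<times> UNIV"
    using a(1) flip_letter_in by auto
  have "reduced_word [l]" "reduced_word [flip_letter l]" by (auto simp: reduced_word_def)
  note distinct = reduced_unique[OF single(1) _ this(1)] reduced_unique[OF single this]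
  have a_inv: "a \<noteq> inv a"
    using distinct(2) a letter_value_flip[OF a(1)] by (auto simp: flip_letter_def prod_eq_iff)
  have a_one: "a \<noteq> \<one>"
    using distinct(1)[of "[]"] a by auto
  have inv_a_one: "inv a \<noteq> \<one>" "\<one> \<noteq> inv a" using a_one by (metis a_closed inv_inv inv_one)+
  define e where "e w = int (count_list w a) - int (count_list w (inv a))" for w :: "'a list"
  have wp_e: "wp w = a [^] e w" if "set w \<subseteq> T" for w
    using that
  proof (induction w)
    case (Cons g w)
    then have "wp w = a [^] e w" and g: "g = a \<or> g = inv a \<or> g = \<one>" using T by auto
    then show ?case
    proof (elim disjE)
      assume "g = a"
      then have "a [^] e (g # w) = a [^] (1 + e w)" using a_inv by (simp add: e_def algebra_simps)
      then show ?thesis using \<open>g = a\<close> \<open>wp w = _\<close> by (simp add: int_pow_mult)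
    next
      assume "g = inv a"
      then have "e (g # w) = - 1 + e w" using a_inv by (simp add: e_def)
      then show ?thesis using \<open>g = inv a\<close> \<open>wp w = _\<close>
        by (simp only: int_pow_mult[OF a_closed] int_pow_neg[OF a_closed] int_pow_1[OF a_closed] wp_simps)
    next
      assume "g = \<one>"
      then have "e (g # w) = e w" using a_one inv_a_one by (auto simp: e_def)
      then show ?thesis using \<open>g = \<one>\<close> \<open>wp w = _\<close> by simp
    qed
  qed (simp add: e_def)
  have len_e: "real (len (wp w)) = real_of_int \<bar>e w\<bar>" if "set w \<subseteq> T" for w
    using len_int_pow[OF a(1), of "e w"] wp_e[OF that] a(2) by simp
  define mir where "mir w = map (m_inv G) w" for w
  have mir_T: "set (mir w) \<subseteq> T" if "set w \<subseteq> T" for w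
  proof -
    have "inv g \<in> T" if "g \<in> T" for g
      using that T(1,2) subsetD[OF T(3) that] by auto
    then show ?thesis using that by (auto simp: mir_def)
  qed
  have T_cases: "g = a \<or> g = inv a \<or> g = \<one>" if "g \<in> T" for g
    using subsetD[OF T(3) that] by simp
  have mir_counts: "count_list (mir w) a = count_list w (inv a) \<and>
      count_list (mir w) (inv a) = count_list w a \<and> count_list (mir w) \<one> = count_list w \<one>"
    if "set w \<subseteq> T" for w
    using that
  proof (induction w)
    case (Cons g w)
    with T_cases[of g] show ?case using a_inv a_one inv_a_one by (auto simp: mir_def)
  qed (auto simp: mir_def)
  have e_mir: "e (mir w) = - e w" if "set w \<subseteq> T" for w
    using mir_counts[OF that] by (simp add: e_def)
  have mir_inj: "inj_on mir (words n)" for n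
  proof (rule inj_onI)
    fix w v assume "w \<in> words n" "v \<in> words n" and eq: "mir w = mir v"
    then have in_T: "set w \<subseteq> carrier G" "set v \<subseteq> carrier G" using T_closed by (auto simp: words_def)
    have "map (m_inv G) (mir u) = u" if "set u \<subseteq> carrier G" for u
      using that by (auto simp: mir_def intro!: map_idI)
    with in_T eq show "w = v" by metis
  qed
  have weight_counts: "weight w = m a ^ count_list w a * m (inv a) ^ count_list w (inv a)
      * m \<one> ^ count_list w \<one>" if "set w \<subseteq> T" for w
    using that
  proof (induction w)
    case (Cons g w)
    then have "g = a \<or> g = inv a \<or> g = \<one>" using T by auto
    with Cons show ?case using a_inv a_one inv_a_one by auto
  qed simp
  have m_nonneg: "0 \<le> m a" "0 \<le> m (inv a)" using T m_pos by (auto intro: less_imp_le)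
  have mir_heavier: "weight w \<le> weight (mir w)" if w: "set w \<subseteq> T" and neg: "e w < 0" for w
  proof -
    define i j where "i = count_list w a" and "j = count_list w (inv a)"
    obtain h where j: "j = i + h" using neg by (auto simp: e_def i_def j_def dest!: less_imp_le nat_le_iff_add[THEN iffD1])
    have one: "0 \<le> m \<one> ^ count_list w \<one>"
    proof (cases "\<one> \<in> T")
      case True then show ?thesis using m_pos by (intro zero_le_power less_imp_le)
    next
      case False
      then have "count_list w \<one> = 0" using w by (intro count_notin) auto
      then show ?thesis by simp
    qed
    have "m (inv a) ^ h \<le> m a ^ h" using le m_nonneg by (intro power_mono)
    then have "m a ^ i * m (inv a) ^ i * m (inv a) ^ h \<le> m a ^ i * m (inv a) ^ i * m a ^ h"
      using m_nonneg by (intro mult_left_mono) auto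
    then have "m a ^ i * m (inv a) ^ j \<le> m a ^ j * m (inv a) ^ i"
      by (simp add: j power_add ac_simps)
    from mult_right_mono[OF this one] show ?thesis
      unfolding weight_counts[OF w] weight_counts[OF mir_T[OF w]] mir_counts[OF w, THEN conjunct1]
        mir_counts[OF w, THEN conjunct2, THEN conjunct1] mir_counts[OF w, THEN conjunct2, THEN conjunct2]
      by (simp add: i_def j_def)
  qed
  define fl where "fl i w = (if i then mir w else w)" for i :: bool and w
  have fl_T: "set (fl i w) \<subseteq> T" if "set w \<subseteq> T" for i w
    using mir_T[OF that] that by (simp add: fl_def)
  have "1 * law n x p * law k y q
      \<le> (\<Sum>j\<in>(UNIV :: (bool \<times> bool) set). law (n + k + 0) (x + y) (p + q + 1))"
  proof (rule law_product_le[where \<phi> = "\<lambda>j w v. fl (fst j) w @ fl (snd j) v"])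
    fix j :: "bool \<times> bool" and w v assume "w \<in> words n" "v \<in> words k"
    then show "fl (fst j) w @ fl (snd j) v \<in> words (n + k + 0)"
      using fl_T by (auto simp: words_def fl_def mir_def)
  next
    fix j :: "bool \<times> bool"
    have fl_inj: "inj_on (fl i) (words n)" for i n
      using mir_inj by (cases i) (auto simp: fl_def inj_on_def)
    have fl_len: "length (fl i w) = length w" for i w by (simp add: fl_def mir_def)
    show "inj_on (\<lambda>(w, v). fl (fst j) w @ fl (snd j) v) (words n \<times> words k)"
    proof (rule inj_onI, clarify)
      fix w v w' v'
      assume in_words: "w \<in> words n" "v \<in> words k" "w' \<in> words n" "v' \<in> words k"
        and eq: "fl (fst j) w @ fl (snd j) v = fl (fst j) w' @ fl (snd j) v'"
      have "length (fl (fst j) w) = length (fl (fst j) w')"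
        using in_words by (simp add: fl_len words_def)
      with eq have "fl (fst j) w = fl (fst j) w'" "fl (snd j) v = fl (snd j) v'" by auto
      with fl_inj in_words show "w = w' \<and> v = v'" by (auto dest: inj_onD)
    qed
  next
    fix w v assume "w \<in> words n" "v \<in> words k"
    then have in_T: "set w \<subseteq> T" "set v \<subseteq> T" by (auto simp: words_def)
    have fl_good: "weight u \<le> weight (fl (e u < 0) u)" "e (fl (e u < 0) u) = \<bar>e u\<bar>" if "set u \<subseteq> T" for u
      using mir_heavier[OF that] e_mir[OF that] by (auto simp: fl_def)
    define u where "u = fl (e w < 0) w @ fl (e v < 0) v"
    have u_T: "set u \<subseteq> T" using fl_T in_T by (auto simp: u_def)
    have "e u = e (fl (e w < 0) w) + e (fl (e v < 0) v)" by (simp add: u_def e_def)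
    then have "\<bar>e u\<bar> = \<bar>e w\<bar> + \<bar>e v\<bar>" using fl_good(2) in_T by simp
    then have "real (len (wp u)) = real (len (wp w)) + real (len (wp v))"
      using len_e in_T u_T by simp
    moreover have "weight w * weight v \<le> weight u"
      unfolding u_def weight_simps using fl_good(1) in_T weight_pos fl_T
      by (intro mult_mono) (auto intro: less_imp_le)
    ultimately show "\<exists>j\<in>UNIV. 1 * weight w * weight v \<le> weight (fl (fst j) w @ fl (snd j) v) \<and>
        \<bar>real (len (wp (fl (fst j) w @ fl (snd j) v))) - (real (len (wp w)) + real (len (wp v)))\<bar> \<le> 1"
      by (intro bexI[of _ "(e w < 0, e v < 0)"]) (auto simp: u_def)
  qed simp
  then show ?thesis by simp
qed

text \<open>
  The sum of two laws on the right accounts for the possible extra step spent on a separating letter.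
\<close>

lemma law_concat:
  "\<exists>c>0. \<forall>n k a b x y. c * law n a x * law k b y
     \<le> law (n + k) (a + b) (x + y + 1) + law (n + k + 1) (a + b) (x + y + 1)"
proof (cases "\<exists>s\<in>S. s \<in> T \<and> inv s \<in> T \<and> T \<subseteq> {s, inv s, \<one>}")
  case False
  then show ?thesis by (rule law_concat_free)
next
  case True
  then obtain s where s: "s \<in> S" "s \<in> T" "inv s \<in> T" "T \<subseteq> {s, inv s, \<one>}" by blast
  then have "s \<in> carrier G" using S_carrier by auto
  then have "\<exists>l a. l \<in> S \<times> UNIV \<and> a = letter_value G l \<and> a \<in> T \<and> inv a \<in> T \<and> T \<subseteq> {a, inv a, \<one>} \<and>
      m (inv a) \<le> m a"
  proof (cases "m (inv s) \<le> m s")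
    case True
    then show ?thesis using s by (intro exI[of _ "(s, True)"] exI[of _ s]) (auto simp: letter_value_def)
  next
    case False
    then show ?thesis using s \<open>s \<in> carrier G\<close>
      by (intro exI[of _ "(s, False)"] exI[of _ "inv s"]) (auto simp: letter_value_def)
  qed
  then obtain l a where la: "l \<in> S \<times> UNIV" "a = letter_value G l" "a \<in> T" "inv a \<in> T"
    "T \<subseteq> {a, inv a, \<one>}" "m (inv a) \<le> m a" by blast
  show ?thesis
  proof (intro exI[of _ "1 / 4"] conjI allI)
    fix n k x y p q
    show "1 / 4 * law n x p * law k y q
        \<le> law (n + k) (x + y) (p + q + 1) + law (n + k + 1) (x + y) (p + q + 1)"
      using law_concat_cyclic[OF la, of n x p k y q] law_nonneg[of "n + k + 1" "x + y" "p + q + 1"]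
      by simp
  qed simp
qed

end

section \<open>The random walk\<close>

lemma (in free_group_basis) carrier_countable:
  assumes "countable S"
  shows "countable (carrier G)"
proof -
  have "carrier G \<subseteq> val ` lists (S \<times> UNIV)"
    using exists_reduced_word by (fastforce simp: lists_eq_set)
  moreover have "countable (val ` lists (S \<times> (UNIV :: bool set)))"
    using assms by (intro countable_image countable_lists countable_SIGMA) auto
  ultimately show ?thesis by (rule countable_subset)
qed

locale free_group_walk = free_group_basis G S + prob_space M
  for G (structure) and S :: "'a set" and M :: "'w measure" +
  fixes \<mu> :: "'a measure" and X :: "nat \<Rightarrow> 'w \<Rightarrow> 'a"
  assumes S_finite: "finite S"
    and mu_prob: "prob_space \<mu>" and mu_sets: "sets \<mu> = Pow (carrier G)"
    and support: "{g \<in> carrier G. measure \<mu> {g} > 0} \<subseteq> S \<union> m_inv G ` S \<union> {\<one>}"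
    and X_indep: "indep_vars (\<lambda>_. \<mu>) X {1..}"
    and X_distr: "\<And>n. n \<ge> 1 \<Longrightarrow> distr M \<mu> (X n) = \<mu>"
begin

definition T :: "'a set" where "T = {g \<in> carrier G. measure \<mu> {g} > 0}"

sublocale weighted_steps G S T "\<lambda>g. measure \<mu> {g}"
proof
  show T_sub: "T \<subseteq> S \<union> m_inv G ` S \<union> {\<one>}" using support by (simp add: T_def)
  then show "finite T" by (rule finite_subset) (use S_finite in auto)
qed (auto simp: T_def)

abbreviation Y :: "nat \<Rightarrow> 'w \<Rightarrow> 'a" where "Y \<equiv> right_walk G X"

lemma countable_carrier: "countable (carrier G)"
  using S_finite by (intro carrier_countable countable_finite)

lemma sets_mu_eq: "sets \<mu> = sets (count_space (carrier G))"
  by (simp add: mu_sets)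

lemma mu_space: "space \<mu> = carrier G"
  using sets_eq_imp_space_eq[OF sets_mu_eq] by simp

lemma X_measurable: "1 \<le> i \<Longrightarrow> X i \<in> M \<rightarrow>\<^sub>M \<mu>"
  using X_indep by (auto simp: indep_vars_def2)

lemma X_measurable_count_space: "1 \<le> i \<Longrightarrow> X i \<in> M \<rightarrow>\<^sub>M count_space (carrier G)"
  using X_measurable measurable_cong_sets[OF refl sets_mu_eq] by blast

text \<open>
  The group is countable, so the step distribution gives no mass to the complement of the set of its atoms.
\<close>

lemma X_in_T:
  assumes "1 \<le> i"
  shows "AE \<omega> in M. X i \<omega> \<in> T"
proof -
  interpret mu: prob_space \<mu> by (rule mu_prob)
  have "(\<Union>g\<in>carrier G - T. {g}) \<in> null_sets \<mu>"
  proof (rule null_sets_UN')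
    show "countable (carrier G - T)" using countable_carrier by (rule countable_Diff)
    fix g assume "g \<in> carrier G - T"
    then show "{g} \<in> null_sets \<mu>"
      by (auto simp: null_sets_def mu_sets T_def mu.emeasure_eq_measure not_less measure_le_0_iff)
  qed
  then have "AE g in \<mu>. g \<notin> carrier G - T" by (intro AE_not_in) simp
  then have "AE g in \<mu>. g \<in> T"
    using AE_space[of \<mu>] by eventually_elim (auto simp: mu_space)
  then have "AE g in distr M \<mu> (X i). g \<in> T" by (subst X_distr[OF assms])
  then show ?thesis by (rule AE_distrD[OF X_measurable[OF assms]])
qed

lemma Y_measurable: "Y n \<in> M \<rightarrow>\<^sub>M count_space (carrier G)"
proof (induction n)
  case (Suc n)
  have "(\<lambda>\<omega>. Y n \<omega> \<otimes> X (Suc n) \<omega>) \<in> M \<rightarrow>\<^sub>M count_space (carrier G)"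
  proof (rule measurable_compose_countable'[OF _ Suc.IH countable_carrier])
    fix g assume "g \<in> carrier G"
    then have "(\<lambda>h. g \<otimes> h) \<in> count_space (carrier G) \<rightarrow>\<^sub>M count_space (carrier G)" by auto
    from measurable_compose[OF X_measurable_count_space this, of "Suc n"]
    show "(\<lambda>\<omega>. g \<otimes> X (Suc n) \<omega>) \<in> M \<rightarrow>\<^sub>M count_space (carrier G)" by simp
  qed
  then show ?case by simp
qed simp

abbreviation L :: "nat \<Rightarrow> 'w \<Rightarrow> nat" where "L n \<omega> \<equiv> len (Y n \<omega>)"

lemma L_measurable: "L n \<in> M \<rightarrow>\<^sub>M count_space UNIV"
  by (rule measurable_compose[OF Y_measurable]) simp

definition steps :: "nat \<Rightarrow> 'w \<Rightarrow> 'a list" where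
  "steps n \<omega> = map (\<lambda>i. X (Suc i) \<omega>) [0..<n]"

lemma X_carrier: "\<omega> \<in> space M \<Longrightarrow> X (Suc i) \<omega> \<in> carrier G"
  using measurable_space[OF X_measurable_count_space[of "Suc i"]] by simp

lemma wp_steps: "\<omega> \<in> space M \<Longrightarrow> wp (steps n \<omega>) = Y n \<omega>"
proof (induction n)
  case (Suc n)
  have "steps (Suc n) \<omega> = steps n \<omega> @ [X (Suc n) \<omega>]" by (simp add: steps_def)
  moreover have "set (steps n \<omega>) \<subseteq> carrier G" using X_carrier[OF Suc.prems] by (auto simp: steps_def)
  ultimately show ?case using X_carrier[OF Suc.prems] Suc by (simp add: wp_append)
qed (simp add: steps_def)

lemma steps_in_words: "AE \<omega> in M. steps n \<omega> \<in> words n"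
proof -
  have "AE \<omega> in M. \<forall>i\<in>{..<n}. X (Suc i) \<omega> \<in> T"
    by (intro AE_finite_allI) (auto intro: X_in_T)
  then show ?thesis by eventually_elim (auto simp: steps_def words_def)
qed

lemma steps_event:
  "{\<omega> \<in> space M. steps n \<omega> = w} \<in> events"
  and steps_prob: "w \<in> words n \<Longrightarrow> prob {\<omega> \<in> space M. steps n \<omega> = w} = weight w"
proof -
  have eq: "{\<omega> \<in> space M. steps n \<omega> = w} =
      (if length w = n then space M \<inter> (\<Inter>i\<in>{..<n}. X (Suc i) -` {w ! i} \<inter> space M) else {})"
    by (auto simp: steps_def list_eq_iff_nth_eq)
  have ev: "X (Suc i) -` {g} \<inter> space M \<in> events" for i g
  proof (cases "g \<in> carrier G")
    case True
    then show ?thesis by (intro measurable_sets[OF X_measurable]) (auto simp: mu_sets)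
  next
    case False
    then have "X (Suc i) -` {g} \<inter> space M = {}" using X_carrier by auto
    then show ?thesis by simp
  qed
  show "{\<omega> \<in> space M. steps n \<omega> = w} \<in> events"
  proof (cases "n = 0")
    case False
    then have "(\<Inter>i\<in>{..<n}. X (Suc i) -` {w ! i} \<inter> space M) \<in> events"
      by (intro sets.finite_INT ev) auto
    then show ?thesis unfolding eq by (auto intro: sets.Int)
  next
    case True
    then show ?thesis unfolding eq by simp
  qed
  assume w: "w \<in> words n"
  then have w_len: "length w = n" and w_T: "set w \<subseteq> T" by (auto simp: words_def)
  have w_closed: "w ! i \<in> carrier G" if "i < n" for i
    using that w_len w_T T_closed nth_mem by blast
  have atom: "prob (X (Suc i) -` {g} \<inter> space M) = measure \<mu> {g}" if "g \<in> carrier G" for i g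
  proof -
    have "measure \<mu> {g} = measure (distr M \<mu> (X (Suc i))) {g}" using X_distr[of "Suc i"] by simp
    also have "\<dots> = prob (X (Suc i) -` {g} \<inter> space M)"
      using that by (intro measure_distr X_measurable) (auto simp: mu_sets)
    finally show ?thesis by simp
  qed
  show "prob {\<omega> \<in> space M. steps n \<omega> = w} = weight w"
  proof (cases "n = 0")
    case True
    then show ?thesis unfolding eq using w_len by (simp add: prob_space)
  next
    case False
    define A where "A i = {w ! (i - 1)}" for i :: nat
    have "{\<omega> \<in> space M. steps n \<omega> = w} = (\<Inter>i\<in>Suc ` {..<n}. X i -` A i \<inter> space M)"
      using False w_len by (auto simp: eq A_def)
    also have "prob \<dots> = (\<Prod>i\<in>Suc ` {..<n}. prob (X i -` A i \<inter> space M))"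
      using False w_closed by (intro indep_varsD[OF X_indep]) (auto simp: A_def mu_sets)
    also have "\<dots> = (\<Prod>i<n. measure \<mu> {w ! i})"
      using w_closed by (simp add: prod.reindex A_def atom)
    also have "\<dots> = weight w"
      by (simp add: weight_def prod.list_conv_set_nth w_len lessThan_atLeast0)
    finally show ?thesis .
  qed
qed

lemma window_prob_law: "window_prob M L n a v = law n a v"
proof -
  have meas: "{\<omega> \<in> space M. \<bar>real (L n \<omega>) - a\<bar> \<le> v} \<in> events"
    using L_measurable[of n] by measurable
  have "window_prob M L n a v = prob (\<Union>w\<in>window_words n a v. {\<omega> \<in> space M. steps n \<omega> = w})"
    unfolding window_prob_def
  proof (rule finite_measure_eq_AE)
    show "AE \<omega> in M. (\<omega> \<in> {\<omega> \<in> space M. \<bar>real (L n \<omega>) - a\<bar> \<le> v}) =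
        (\<omega> \<in> (\<Union>w\<in>window_words n a v. {\<omega> \<in> space M. steps n \<omega> = w}))"
      using steps_in_words[of n] AE_space
      by eventually_elim (auto simp: window_words_def wp_steps)
    show "(\<Union>w\<in>window_words n a v. {\<omega> \<in> space M. steps n \<omega> = w}) \<in> events"
      by (intro sets.finite_UN) (auto intro: steps_event)
  qed (rule meas)
  also have "\<dots> = (\<Sum>w\<in>window_words n a v. prob {\<omega> \<in> space M. steps n \<omega> = w})"
    by (rule finite_measure_finite_Union)
       (use steps_event in \<open>auto simp: disjoint_family_on_def\<close>)
  also have "\<dots> = law n a v"
    unfolding law_def by (intro sum.cong refl steps_prob) (auto simp: window_words_def)
  finally show ?thesis .
qed

lemma len_one: "len \<one> = 0"
  using len_reduced[of "[]"] by simp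

lemma L_step: "AE \<omega> in M. \<bar>real (L (Suc n) \<omega>) - real (L n \<omega>)\<bar> \<le> 1"
proof -
  have "AE \<omega> in M. X (Suc n) \<omega> \<in> T" by (rule X_in_T) simp
  then show ?thesis using AE_space
  proof eventually_elim
    case (elim \<omega>)
    have "Y n \<omega> \<in> carrier G" using measurable_space[OF Y_measurable elim(2)] by simp
    then show ?case using len_mult_generator[of "Y n \<omega>" "X (Suc n) \<omega>"] elim T_sub by auto
  qed
qed

text \<open>
  The extra step for a separating letter is removed by going back one step in time, which changes the
  word length by at most 1; this is why the windows grow by 2.
\<close>

lemma walk_almost_additive: "\<exists>c. almost_additive M L c 2"
proof -
  obtain c where c: "c > 0" "\<And>n k a b x y. c * law n a x * law k b y
     \<le> law (n + k) (a + b) (x + y + 1) + law (n + k + 1) (a + b) (x + y + 1)"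
    using law_concat by auto
  have "almost_additive M L (c / 2) 2"
  proof
    fix n k :: nat and a b x y :: real
    have widen: "law (n + k) (a + b) (x + y + 1) \<le> window_prob M L (n + k) (a + b) (x + y + 2)"
      unfolding window_prob_law[symmetric] window_prob_def
      using L_measurable[of "n + k"] by (intro finite_measure_mono) (auto, measurable)
    have "law (n + k + 1) (a + b) (x + y + 1) \<le> window_prob M L (n + k) (a + b) (x + y + 2)"
      unfolding window_prob_law[symmetric] window_prob_def
    proof (rule finite_measure_mono_AE)
      show "AE \<omega> in M. \<omega> \<in> {\<omega> \<in> space M. \<bar>real (L (n + k + 1) \<omega>) - (a + b)\<bar> \<le> x + y + 1} \<longrightarrow>
          \<omega> \<in> {\<omega> \<in> space M. \<bar>real (L (n + k) \<omega>) - (a + b)\<bar> \<le> x + y + 2}"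
        using L_step[of "n + k"] by eventually_elim auto
      show "{\<omega> \<in> space M. \<bar>real (L (n + k) \<omega>) - (a + b)\<bar> \<le> x + y + 2} \<in> events"
        using L_measurable[of "n + k"] by measurable
    qed
    with widen c(2)[of n a x k b y]
    show "c / 2 * window_prob M L n a x * window_prob M L k b y
        \<le> window_prob M L (n + k) (a + b) (x + y + 2)"
      by (simp add: window_prob_law)
  qed (use c(1) L_measurable L_step len_one in auto)
  then show ?thesis ..
qed

end

theorem corollary1p5:
  fixes G :: "('a, 'b) monoid_scheme" and S :: "'a set" and r :: nat
    and \<mu> :: "'a measure" and M :: "'w measure" and X :: "nat \<Rightarrow> 'w \<Rightarrow> 'a"
  assumes "group G"
    and "free_generators G S" and "finite S" and "card S = r" and "r \<ge> 1"
    and "prob_space \<mu>" and "sets \<mu> = Pow (carrier G)"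
    and "{g \<in> carrier G. measure \<mu> {g} > 0} \<subseteq> S \<union> m_inv G ` S \<union> {\<one>\<^bsub>G\<^esub>}"
    and "prob_space M"
    and "prob_space.indep_vars M (\<lambda>_. \<mu>) X {1..}"
    and "\<And>n. n \<ge> 1 \<Longrightarrow> distr M \<mu> (X n) = \<mu>"
  shows "\<exists>I :: real \<Rightarrow> ereal.
    large_deviation_principle M (top_of_set {0..})
      (\<lambda>n \<omega>. real (word_length G S (right_walk G X n \<omega>)) / real n) I \<and>
    proper_rate (top_of_set {0..}) I \<and>
    ereal_convex_on {0..} I \<and>
    (\<forall>x\<ge>0. I x =
       fenchel_legendre
         (limiting_log_mgf M (\<lambda>n \<omega>. real (word_length G S (right_walk G X n \<omega>)))) x)"
proof -
  interpret group G by fact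
  interpret prob_space M by fact
  interpret free_group_walk G S M \<mu> X
    by (intro free_group_walk.intro free_group_basis.intro free_group_basis_axioms.intro
        free_group_walk_axioms.intro assms)
  obtain c where "almost_additive M L c 2" using walk_almost_additive ..
  then interpret LDP: almost_additive M L c 2 .
  show ?thesis
    using LDP.ldp by (intro exI[of _ LDP.rate]) (simp add: LDP.rate_def)
qed

end
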